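(* Let $\mathcal{CS}$ be a constant specification. Then an arbitrary $\Gamma\subseteq Form$ is consistent relative to the axiomatic system $\Sigma_{\mathcal{CS}}$ iff $\Gamma$ is satisfiable in a jstit model (equivalently, in a unirelational jstit model) satisfying: for every $c\in PConst$ and every $m\in Tree$, $\{A \mid c{:}A\in\mathcal{CS}\}\subseteq\mathcal{E}(m,c)$.
   Context: Fix a finite nonempty set $Ag$ of agents and countably infinite, pairwise disjoint sets $PVar$, $PConst$, $Var$ of proof variables, proof constants, propositional variables. $Pol$: $t ::= x \mid c \mid s+t \mid s\times t \mid\ !t$. $Form$: $A ::= p \mid A\wedge B \mid \neg A \mid [j]A \mid \Box A \mid t{:}A \mid KA \mid Et$ ($j\in Ag$); $\Diamond=\neg\Box\neg$. A jstit model is $\langle Tree,\unlhd,Choice,Act,R,R_e,\mathcal{E},V\rangle$: $Tree\neq\emptyset$; $\unlhd$ a partial order ($\lhd$ strict); histories = maximal $\unlhd$-chains, $H_m$ = histories through $m$, $MH=\{(m,h):h\in H_m\}$; $Choice^m_j$ a partition of $H_m$ with cell $Choice^m_j(h)$; $Act:MH\to 2^{Pol}$; $R\subseteq R_e$ preorders on $Tree$; $\mathcal{E}:Tree\times Pol\to 2^{Form}$; $V:Var\to 2^{MH}$; subject to: (1) any two moments have a common lower bound; (2) $m_1,m_2\unlhd m$ imply $m_1,m_2$ comparable; (3) if $h,h'\in H_m$ share some $m'\rhd m$ then $Choice^m_j(h)=Choice^m_j(h')$; (4) any selection of one cell of $Choice^m_j$ for each $j$ has nonempty intersection; (5) $R_e(m,m')\Rightarrow\mathcal{E}(m,t)\subseteq\mathcal{E}(m',t)$;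 (6) $A\to B\in\mathcal{E}(m,s)\,\&\,A\in\mathcal{E}(m,t)\Rightarrow B\in\mathcal{E}(m,s\times t)$; $\mathcal{E}(m,s)\cup\mathcal{E}(m,t)\subseteq\mathcal{E}(m,s+t)$; $A\in\mathcal{E}(m,t)\Rightarrow t{:}A\in\mathcal{E}(m,!t)$; (7) $m'\lhd m$, $h\in H_m\Rightarrow Act(m',h)\subseteq Act(m,h)$; (8) $\bigcap_{h\in H_m}Act(m,h)\subseteq\bigcup_{m'\lhd m,h\in H_m}Act(m',h)$; (9) if $h,h'\in H_m$ share some $m'\rhd m$ then $Act(m,h)=Act(m,h')$; (10) $\unlhd\subseteq R$; (11) $R_e(m,m')\Rightarrow\bigcap_{h\in H_m}Act(m,h)\subseteq\bigcap_{h'\in H_{m'}}Act(m',h')$. Truth at $(m,h)$: $p$ iff $(m,h)\in V(p)$; Booleans standard; $[j]A$: $A$ at all $(m,h')$, $h'\in Choice^m_j(h)$; $\Box A$: $A$ at all $(m,h')$, $h'\in H_m$; $KA$: $A$ at all $(m',h')$ with $R(m,m')$, $h'\in H_{m'}$; $t{:}A$: $A\in\mathcal{E}(m,t)$ and $A$ at all $(m',h')$ with $R_e(m,m')$, $h'\in H_{m'}$; $Et$: $t\in Act(m,h)$. Unirelational: $R_e\subseteq R$. Axiom schemes: (A0) propositional tautologies; (A1) S5 axioms for $\Box$ and each $[j]$; (A2) $\Box A\to[j]A$; (A3) $(\Diamond[j_1]A_1\wedge\dots\wedge\Diamond[j_n]A_n)\to\Diamond([j_1]A_1\wedge\dots\wedge[j_n]A_n)$,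 $j_i$ distinct; (A4) $s{:}(A\to B)\to(t{:}A\to(s\times t){:}B)$; (A5) $t{:}A\to(!t{:}(t{:}A)\wedge KA)$; (A6) $(s{:}A\vee t{:}A)\to(s+t){:}A$; (A7) S4 axioms for $K$; (A8) $KA\to\Box K\Box A$; (A9) $\Box Et\to K\Box Et$. Rules: (R1) modus ponens; (R2) from $A$ infer $KA$; (R4) from $KA\to(\neg\Box Et_1\vee\dots\vee\neg\Box Et_n)$ infer $KA\to(\neg Et_1\vee\dots\vee\neg Et_n)$. A constant specification is a set $\mathcal{CS}\subseteq\{c_n{:}\dots c_1{:}A \mid c_1,\dots,c_n\in PConst,\ A$ an instance of (A0)–(A9)$\}$ such that $c_{n+1}{:}c_n{:}\dots c_1{:}A\in\mathcal{CS}$ implies $c_n{:}\dots c_1{:}A\in\mathcal{CS}$. Rule $(R_{\mathcal{CS}})$: infer any member of $\mathcal{CS}$. $\Sigma_{\mathcal{CS}}$ consists of (A0)–(A9), (R1), (R2), (R4), $(R_{\mathcal{CS}})$. $\Gamma$ is inconsistent relative to $\Sigma_{\mathcal{CS}}$ iff $(A_1\wedge\dots\wedge A_n)\to\bot$ is derivable in $\Sigma_{\mathcal{CS}}$ for some $A_1,\dots,A_n\in\Gamma$; consistent otherwise. *)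

theory Defs
  imports "HOL-Library.Disjoint_Sets"
begin

section \<open>Language\<close>

datatype pol =
    PVar nat
  | PConst nat
  | PSum pol pol
  | PTimes pol pol
  | PBang pol

text \<open>The type parameter is the set of agents. \<open>Presented t\<close> is the formula $Et$.\<close>

datatype 'ag form =
    Var nat
  | Conj "'ag form" "'ag form"  (infixr "\<^bold>\<and>" 35)
  | Neg "'ag form"  ("\<^bold>\<not> _" [40] 40)
  | Stit 'ag "'ag form"
  | Box "'ag form"
  | Just pol "'ag form"  (infixr "\<^bold>:" 70)
  | Know "'ag form"
  | Presented pol

abbreviation Disj :: "'ag form \<Rightarrow> 'ag form \<Rightarrow> 'ag form"  (infixr "\<^bold>\<or>" 30)
  where "A \<^bold>\<or> B \<equiv> \<^bold>\<not> (\<^bold>\<not> A \<^bold>\<and> \<^bold>\<not> B)"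

abbreviation Imp :: "'ag form \<Rightarrow> 'ag form \<Rightarrow> 'ag form"  (infixr "\<^bold>\<longrightarrow>" 25)
  where "A \<^bold>\<longrightarrow> B \<equiv> \<^bold>\<not> (A \<^bold>\<and> \<^bold>\<not> B)"

abbreviation Falsum :: "'ag form"  ("\<^bold>\<bottom>")
  where "\<^bold>\<bottom> \<equiv> Var 0 \<^bold>\<and> \<^bold>\<not> Var 0"

abbreviation Dia :: "'ag form \<Rightarrow> 'ag form"
  where "Dia A \<equiv> \<^bold>\<not> Box (\<^bold>\<not> A)"

text \<open>Conjunctions and disjunctions of finite nonempty lists; the empty list is left unspecified.\<close>

fun Conjs :: "'ag form list \<Rightarrow> 'ag form" where
  "Conjs [A] = A"
| "Conjs (A # B # Cs) = (A \<^bold>\<and> Conjs (B # Cs))"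

fun Disjs :: "'ag form list \<Rightarrow> 'ag form" where
  "Disjs [A] = A"
| "Disjs (A # B # Cs) = (A \<^bold>\<or> Disjs (B # Cs))"

section \<open>Models\<close>

record ('ag, 'm) jstit =
  Tree :: "'m set"
  le :: "('m \<times> 'm) set"
  Choice :: "'m \<Rightarrow> 'ag \<Rightarrow> 'm set set set"
  Act :: "'m \<Rightarrow> 'm set \<Rightarrow> pol set"
  R :: "('m \<times> 'm) set"
  Re :: "('m \<times> 'm) set"
  Evid :: "'m \<Rightarrow> pol \<Rightarrow> 'ag form set"
  Val :: "nat \<Rightarrow> ('m \<times> 'm set) set"

definition lt :: "('ag, 'm) jstit \<Rightarrow> ('m \<times> 'm) set" where
  "lt M = le M - Id"

definition histories :: "('ag, 'm) jstit \<Rightarrow> 'm set set" where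
  "histories M = {h \<in> Chains (le M). \<forall>h' \<in> Chains (le M). h \<subseteq> h' \<longrightarrow> h' = h}"

definition hist_thru :: "('ag, 'm) jstit \<Rightarrow> 'm \<Rightarrow> 'm set set" where
  "hist_thru M m = {h \<in> histories M. m \<in> h}"

definition MH :: "('ag, 'm) jstit \<Rightarrow> ('m \<times> 'm set) set" where
  "MH M = {(m, h). m \<in> Tree M \<and> h \<in> hist_thru M m}"

definition cell :: "('ag, 'm) jstit \<Rightarrow> 'm \<Rightarrow> 'ag \<Rightarrow> 'm set \<Rightarrow> 'm set set" where
  "cell M m j h = (THE C. C \<in> Choice M m j \<and> h \<in> C)"

definition undivided :: "('ag, 'm) jstit \<Rightarrow> 'm \<Rightarrow> 'm set \<Rightarrow> 'm set \<Rightarrow> bool" where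
  "undivided M m h h' \<longleftrightarrow>
     h \<in> hist_thru M m \<and> h' \<in> hist_thru M m \<and> (\<exists>m'. (m, m') \<in> lt M \<and> m' \<in> h \<and> m' \<in> h')"

definition is_jstit_model :: "('ag, 'm) jstit \<Rightarrow> bool" where
  "is_jstit_model M \<longleftrightarrow>
     Tree M \<noteq> {} \<and>
     partial_order_on (Tree M) (le M) \<and>
     preorder_on (Tree M) (R M) \<and>
     preorder_on (Tree M) (Re M) \<and>
     R M \<subseteq> Re M \<and>
     (\<forall>m \<in> Tree M. \<forall>j. partition_on (hist_thru M m) (Choice M m j)) \<and>
     (\<forall>p. Val M p \<subseteq> MH M) \<and>
     (\<forall>m1 \<in> Tree M. \<forall>m2 \<in> Tree M. \<exists>m \<in> Tree M. (m, m1) \<in> le M \<and> (m, m2) \<in> le M) \<and>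
     (\<forall>m1 m2 m. (m1, m) \<in> le M \<and> (m2, m) \<in> le M \<longrightarrow> (m1, m2) \<in> le M \<or> (m2, m1) \<in> le M) \<and>
     (\<forall>m \<in> Tree M. \<forall>h h' j. undivided M m h h' \<longrightarrow> cell M m j h = cell M m j h') \<and>
     (\<forall>m \<in> Tree M. \<forall>f. (\<forall>j. f j \<in> Choice M m j) \<longrightarrow> (\<Inter>j. f j) \<noteq> {}) \<and>
     (\<forall>m m' t. (m, m') \<in> Re M \<longrightarrow> Evid M m t \<subseteq> Evid M m' t) \<and>
     (\<forall>m \<in> Tree M. \<forall>s t A B.
        ((A \<^bold>\<longrightarrow> B) \<in> Evid M m s \<and> A \<in> Evid M m t \<longrightarrow> B \<in> Evid M m (PTimes s t)) \<and>
        Evid M m s \<union> Evid M m t \<subseteq> Evid M m (PSum s t) \<and>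
        (A \<in> Evid M m t \<longrightarrow> (t \<^bold>: A) \<in> Evid M m (PBang t))) \<and>
     (\<forall>m m' h. (m', m) \<in> lt M \<and> h \<in> hist_thru M m \<longrightarrow> Act M m' h \<subseteq> Act M m h) \<and>
     (\<forall>m \<in> Tree M. (\<Inter>h \<in> hist_thru M m. Act M m h)
        \<subseteq> (\<Union>m' \<in> {m'. (m', m) \<in> lt M}. \<Union>h \<in> hist_thru M m. Act M m' h)) \<and>
     (\<forall>m \<in> Tree M. \<forall>h h'. undivided M m h h' \<longrightarrow> Act M m h = Act M m h') \<and>
     le M \<subseteq> R M \<and>
     (\<forall>m m'. (m, m') \<in> Re M \<longrightarrow>
        (\<Inter>h \<in> hist_thru M m. Act M m h) \<subseteq> (\<Inter>h' \<in> hist_thru M m'. Act M m' h'))"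

definition unirelational :: "('ag, 'm) jstit \<Rightarrow> bool" where
  "unirelational M \<longleftrightarrow> Re M \<subseteq> R M"

primrec holds :: "('ag, 'm) jstit \<Rightarrow> 'm \<Rightarrow> 'm set \<Rightarrow> 'ag form \<Rightarrow> bool" where
  "holds M m h (Var p) \<longleftrightarrow> (m, h) \<in> Val M p"
| "holds M m h (A \<^bold>\<and> B) \<longleftrightarrow> holds M m h A \<and> holds M m h B"
| "holds M m h (\<^bold>\<not> A) \<longleftrightarrow> \<not> holds M m h A"
| "holds M m h (Stit j A) \<longleftrightarrow> (\<forall>h' \<in> cell M m j h. holds M m h' A)"
| "holds M m h (Box A) \<longleftrightarrow> (\<forall>h' \<in> hist_thru M m. holds M m h' A)"
| "holds M m h (t \<^bold>: A) \<longleftrightarrow>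
     A \<in> Evid M m t \<and> (\<forall>m'. (m, m') \<in> Re M \<longrightarrow> (\<forall>h' \<in> hist_thru M m'. holds M m' h' A))"
| "holds M m h (Know A) \<longleftrightarrow>
     (\<forall>m'. (m, m') \<in> R M \<longrightarrow> (\<forall>h' \<in> hist_thru M m'. holds M m' h' A))"
| "holds M m h (Presented t) \<longleftrightarrow> t \<in> Act M m h"

definition satisfied_in :: "('ag, 'm) jstit \<Rightarrow> 'ag form set \<Rightarrow> bool" where
  "satisfied_in M \<Gamma> \<longleftrightarrow> (\<exists>(m, h) \<in> MH M. \<forall>A \<in> \<Gamma>. holds M m h A)"

section \<open>Axiomatic systems\<close>

text \<open>Tautologies: every formula whose main connective is not Boolean is treated as an atom.\<close>

fun bool_eval :: "('ag form \<Rightarrow> bool) \<Rightarrow> 'ag form \<Rightarrow> bool" where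
  "bool_eval v (A \<^bold>\<and> B) \<longleftrightarrow> bool_eval v A \<and> bool_eval v B"
| "bool_eval v (\<^bold>\<not> A) \<longleftrightarrow> \<not> bool_eval v A"
| "bool_eval v A \<longleftrightarrow> v A"

definition tautology :: "'ag form \<Rightarrow> bool" where
  "tautology A \<longleftrightarrow> (\<forall>v. bool_eval v A)"

inductive ax :: "'ag form \<Rightarrow> bool" where
  A0: "tautology A \<Longrightarrow> ax A"
| A1_Box_K: "ax (Box (A \<^bold>\<longrightarrow> B) \<^bold>\<longrightarrow> (Box A \<^bold>\<longrightarrow> Box B))"
| A1_Box_T: "ax (Box A \<^bold>\<longrightarrow> A)"
| A1_Box_4: "ax (Box A \<^bold>\<longrightarrow> Box (Box A))"
| A1_Box_5: "ax (\<^bold>\<not> Box A \<^bold>\<longrightarrow> Box (\<^bold>\<not> Box A))"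
| A1_Stit_K: "ax (Stit j (A \<^bold>\<longrightarrow> B) \<^bold>\<longrightarrow> (Stit j A \<^bold>\<longrightarrow> Stit j B))"
| A1_Stit_T: "ax (Stit j A \<^bold>\<longrightarrow> A)"
| A1_Stit_4: "ax (Stit j A \<^bold>\<longrightarrow> Stit j (Stit j A))"
| A1_Stit_5: "ax (\<^bold>\<not> Stit j A \<^bold>\<longrightarrow> Stit j (\<^bold>\<not> Stit j A))"
| A2: "ax (Box A \<^bold>\<longrightarrow> Stit j A)"
| A3: "\<lbrakk>jAs \<noteq> []; distinct (map fst jAs)\<rbrakk> \<Longrightarrow>
    ax (Conjs (map (\<lambda>(j, A). Dia (Stit j A)) jAs) \<^bold>\<longrightarrow>
        Dia (Conjs (map (\<lambda>(j, A). Stit j A) jAs)))"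
| A4: "ax (s \<^bold>: (A \<^bold>\<longrightarrow> B) \<^bold>\<longrightarrow> (t \<^bold>: A \<^bold>\<longrightarrow> PTimes s t \<^bold>: B))"
| A5: "ax (t \<^bold>: A \<^bold>\<longrightarrow> (PBang t \<^bold>: (t \<^bold>: A) \<^bold>\<and> Know A))"
| A6: "ax ((s \<^bold>: A \<^bold>\<or> t \<^bold>: A) \<^bold>\<longrightarrow> PSum s t \<^bold>: A)"
| A7_K: "ax (Know (A \<^bold>\<longrightarrow> B) \<^bold>\<longrightarrow> (Know A \<^bold>\<longrightarrow> Know B))"
| A7_T: "ax (Know A \<^bold>\<longrightarrow> A)"
| A7_4: "ax (Know A \<^bold>\<longrightarrow> Know (Know A))"
| A8: "ax (Know A \<^bold>\<longrightarrow> Box (Know (Box A)))"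
| A9: "ax (Box (Presented t) \<^bold>\<longrightarrow> Know (Box (Presented t)))"

text \<open>The list of constants is read from the outside in:
  \<open>const_just [c\<^sub>n, \<dots>, c\<^sub>1] A\<close> is $c_n{:}\dots c_1{:}A$.\<close>

definition const_just :: "nat list \<Rightarrow> 'ag form \<Rightarrow> 'ag form" where
  "const_just cs A = foldr (\<lambda>c B. PConst c \<^bold>: B) cs A"

definition constant_specification :: "'ag form set \<Rightarrow> bool" where
  "constant_specification CS \<longleftrightarrow>
     CS \<subseteq> {const_just cs A | cs A. cs \<noteq> [] \<and> ax A} \<and>
     (\<forall>c cs A. cs \<noteq> [] \<and> ax A \<and> const_just (c # cs) A \<in> CS \<longrightarrow> const_just cs A \<in> CS)"

inductive derivable :: "'ag form set \<Rightarrow> 'ag form \<Rightarrow> bool" for CS where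
  Ax: "ax A \<Longrightarrow> derivable CS A"
| R1: "\<lbrakk>derivable CS (A \<^bold>\<longrightarrow> B); derivable CS A\<rbrakk> \<Longrightarrow> derivable CS B"
| R2: "derivable CS A \<Longrightarrow> derivable CS (Know A)"
| R4: "\<lbrakk>ts \<noteq> []; derivable CS (Know A \<^bold>\<longrightarrow> Disjs (map (\<lambda>t. \<^bold>\<not> Box (Presented t)) ts))\<rbrakk> \<Longrightarrow>
    derivable CS (Know A \<^bold>\<longrightarrow> Disjs (map (\<lambda>t. \<^bold>\<not> Presented t) ts))"
| R_CS: "A \<in> CS \<Longrightarrow> derivable CS A"

definition inconsistent :: "'ag form set \<Rightarrow> 'ag form set \<Rightarrow> bool" where
  "inconsistent CS \<Gamma> \<longleftrightarrow>
     (\<exists>As. As \<noteq> [] \<and> set As \<subseteq> \<Gamma> \<and> derivable CS (Conjs As \<^bold>\<longrightarrow> \<^bold>\<bottom>))"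

abbreviation consistent :: "'ag form set \<Rightarrow> 'ag form set \<Rightarrow> bool" where
  "consistent CS \<Gamma> \<equiv> \<not> inconsistent CS \<Gamma>"

section \<open>Satisfiability\<close>

definition normal_for :: "'ag form set \<Rightarrow> ('ag, 'm) jstit \<Rightarrow> bool" where
  "normal_for CS M \<longleftrightarrow>
     (\<forall>c. \<forall>m \<in> Tree M. {A. (PConst c \<^bold>: A) \<in> CS} \<subseteq> Evid M m (PConst c))"

text \<open>HOL cannot quantify existentially over the type of moments, so the type is a parameter;
  \<open>Tree\<close> may be any nonempty subset of it.\<close>

definition satisfiable :: "'m itself \<Rightarrow> 'ag form set \<Rightarrow> 'ag form set \<Rightarrow> bool" where
  "satisfiable _ CS \<Gamma> \<longleftrightarrow>
     (\<exists>M :: ('ag, 'm) jstit. is_jstit_model M \<and> normal_for CS M \<and> satisfied_in M \<Gamma>)"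

definition uni_satisfiable :: "'m itself \<Rightarrow> 'ag form set \<Rightarrow> 'ag form set \<Rightarrow> bool" where
  "uni_satisfiable _ CS \<Gamma> \<longleftrightarrow>
     (\<exists>M :: ('ag, 'm) jstit. is_jstit_model M \<and> unirelational M \<and> normal_for CS M \<and>
        satisfied_in M \<Gamma>)"

text \<open>A type of continuum cardinality, used as the universe from which a satisfying model can
  always be drawn. That models over other types satisfy no further sets of formulas has to be stated
  separately.\<close>

type_synonym 'ag moment = "('ag form set \<times> nat) list"

end

theory Submission
  imports Defs
begin

text \<open>Soundness is routine except for (R4): if \<open>Et\<close> holds at \<open>(m, h)\<close> and \<open>h\<close> contains a moment
  \<open>m'\<close> after \<open>m\<close>, then all histories through \<open>m'\<close> are undivided at \<open>m\<close>, so \<open>\<box>Et\<close> holds at \<open>m'\<close>; and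
  if \<open>m\<close> is the last moment of \<open>h\<close>, then \<open>h\<close> is the only history through \<open>m\<close>.

  For completeness, every maximal consistent set \<open>\<Delta>\<close> has a future \<open>\<Theta>\<close>, which contains the knowledge
  of \<open>\<Delta>\<close> and \<open>\<box>Et\<close> for each \<open>Et \<in> \<Delta>\<close>, and in which \<open>Et\<close> already implies \<open>\<box>Et\<close>: these formulas are
  consistent by (R4), and one maximises the set of formulas \<open>\<box>Et\<close>. Directly above the root, the
  canonical tree has one moment for every maximal consistent set. Histories leave a moment with all
  labels \<open>\<Delta>\<close> of its \<open>\<box>\<close>-class, and each branch begins with a trunk: a sequence of moments, of order
  type the reverse of \<open>\<omega>\<close>, of the class of \<open>\<Theta>\<close>. Along the trunk \<open>\<Theta>\<close> is its own future, and as the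
  trunk has no first moment, a proof presented in all histories was always presented before.\<close>

section \<open>Boolean reasoning\<close>

lemma bool_eval_Conjs: "As \<noteq> [] \<Longrightarrow> bool_eval v (Conjs As) \<longleftrightarrow> (\<forall>A\<in>set As. bool_eval v A)"
  by (induction As rule: Conjs.induct) auto

lemma bool_eval_Disjs: "As \<noteq> [] \<Longrightarrow> bool_eval v (Disjs As) \<longleftrightarrow> (\<exists>A\<in>set As. bool_eval v A)"
  by (induction As rule: Disjs.induct) auto

text \<open>Truth at a fixed moment and history is itself a Boolean valuation, since
  \<open>bool_eval\<close> treats every formula with a non-Boolean main connective as an
  atom.\<close>

lemma holds_bool_eval: "bool_eval (holds M m h) A \<longleftrightarrow> holds M m h A"
  by (induction A) auto

lemma holds_Conjs: "As \<noteq> [] \<Longrightarrow> holds M m h (Conjs As) \<longleftrightarrow> (\<forall>A\<in>set As. holds M m h A)"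
  by (metis bool_eval_Conjs holds_bool_eval)

lemma holds_Disjs: "As \<noteq> [] \<Longrightarrow> holds M m h (Disjs As) \<longleftrightarrow> (\<exists>A\<in>set As. holds M m h A)"
  by (metis bool_eval_Disjs holds_bool_eval)

section \<open>Histories\<close>

text \<open>Only order conditions are assumed, so the facts on histories serve both arbitrary models
  and the bare canonical order \<open>frame\<close>.\<close>

locale jstit_tree =
  fixes M :: "('ag, 'm) jstit"
  assumes le_po: "partial_order_on (Tree M) (le M)"
    and no_backward_branching:
      "(m1, m) \<in> le M \<Longrightarrow> (m2, m) \<in> le M \<Longrightarrow> (m1, m2) \<in> le M \<or> (m2, m1) \<in> le M"
begin

lemma le_in_Tree: "(x, y) \<in> le M \<Longrightarrow> x \<in> Tree M \<and> y \<in> Tree M"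
  using le_po by (auto simp: partial_order_on_def preorder_on_def)

lemma le_refl: "x \<in> Tree M \<Longrightarrow> (x, x) \<in> le M"
  using le_po by (auto simp: partial_order_on_def preorder_on_def refl_on_def)

lemma le_trans: "(x, y) \<in> le M \<Longrightarrow> (y, z) \<in> le M \<Longrightarrow> (x, z) \<in> le M"
  using le_po by (auto simp: partial_order_on_def preorder_on_def dest: transD)

lemma chain_in_history:
  assumes "C \<in> Chains (le M)"
  obtains h where "h \<in> histories M" "C \<subseteq> h"
proof -
  let ?X = "{D \<in> Chains (le M). C \<subseteq> D}"
  have "\<exists>D\<in>?X. \<forall>X\<in>?X. D \<subseteq> X \<longrightarrow> X = D"
  proof (rule subset_Zorn_nonempty)
    show "?X \<noteq> {}" using assms by blast
  next
    fix \<C> assume ne: "\<C> \<noteq> {}" and ch: "subset.chain ?X \<C>"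
    have "\<Union>\<C> \<in> Chains (le M)"
      unfolding Chains_def
    proof (intro CollectI ballI)
      fix a b assume "a \<in> \<Union>\<C>" "b \<in> \<Union>\<C>"
      then obtain D D' where D: "D \<in> \<C>" "a \<in> D" "D' \<in> \<C>" "b \<in> D'" by blast
      with ch have "D \<subseteq> D' \<or> D' \<subseteq> D" "D \<in> Chains (le M)" "D' \<in> Chains (le M)"
        unfolding subset.chain_def by blast+
      with D show "(a, b) \<in> le M \<or> (b, a) \<in> le M" unfolding Chains_def by blast
    qed
    moreover have "C \<subseteq> \<Union>\<C>" using ne ch unfolding subset.chain_def by blast
    ultimately show "\<Union>\<C> \<in> ?X" by blast
  qed
  then obtain D where D: "D \<in> ?X" "\<forall>X\<in>?X. D \<subseteq> X \<longrightarrow> X = D" ..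
  have "D \<in> histories M"
    unfolding histories_def
  proof (intro CollectI conjI ballI impI)
    show "D \<in> Chains (le M)" using D(1) by simp
    fix X assume "X \<in> Chains (le M)" "D \<subseteq> X"
    moreover from this D(1) have "X \<in> ?X" by auto
    ultimately show "X = D" using D(2) by simp
  qed
  then show thesis using that D(1) by simp
qed

lemma history_comparable:
  "h \<in> histories M \<Longrightarrow> x \<in> h \<Longrightarrow> y \<in> h \<Longrightarrow> (x, y) \<in> le M \<or> (y, x) \<in> le M"
  by (auto simp: histories_def Chains_def)

lemma history_maximal:
  assumes h: "h \<in> histories M" and y: "y \<in> Tree M"
    and c: "\<And>x. x \<in> h \<Longrightarrow> (x, y) \<in> le M \<or> (y, x) \<in> le M"
  shows "y \<in> h"
proof -
  have "insert y h \<in> Chains (le M)"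
    unfolding Chains_def using history_comparable[OF h] c le_refl[OF y] by blast
  then have "insert y h = h" using h unfolding histories_def by blast
  then show ?thesis by blast
qed

text \<open>A moment of \<open>h\<close> above \<open>y\<close> is above \<open>x\<close>; one below
  \<open>y\<close> is comparable with \<open>x\<close> because there is no backward branching.
  Maximality then puts \<open>x\<close> into \<open>h\<close>.\<close>

lemma history_downward:
  assumes "h \<in> histories M" "y \<in> h" "(x, y) \<in> le M"
  shows "x \<in> h"
proof (rule history_maximal[OF assms(1)])
  show "x \<in> Tree M" using le_in_Tree assms(3) by blast
  fix z assume "z \<in> h"
  then show "(z, x) \<in> le M \<or> (x, z) \<in> le M"
    using history_comparable[OF assms(1,2)] le_trans[OF assms(3)]
      no_backward_branching[OF _ assms(3)] by blast
qed

lemma hist_thru_antimono: "(x, y) \<in> le M \<Longrightarrow> hist_thru M y \<subseteq> hist_thru M x"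
  using history_downward by (auto simp: hist_thru_def)

lemma hist_thru_nonempty:
  assumes "m \<in> Tree M"
  obtains h where "h \<in> hist_thru M m"
proof -
  have "{m} \<in> Chains (le M)" using le_refl[OF assms] by (simp add: Chains_def)
  from chain_in_history[OF this] show thesis using that by (auto simp: hist_thru_def)
qed

text \<open>All of \<open>h\<close> lies below its last moment \<open>m\<close>. A moment of
  \<open>h'\<close> above \<open>m\<close> is thus above all of \<open>h\<close>, and one below
  \<open>m\<close> is in \<open>h\<close> by downward closure. So \<open>h'\<close> is contained in
  \<open>h\<close>, and maximality of \<open>h'\<close> gives equality.\<close>

lemma last_moment_unique_history:
  assumes h: "h \<in> hist_thru M m" and last: "\<And>x. x \<in> h \<Longrightarrow> (m, x) \<notin> lt M"
    and h': "h' \<in> hist_thru M m"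
  shows "h' = h"
proof -
  have hh: "h \<in> histories M" "m \<in> h" "h' \<in> histories M" "m \<in> h'"
    using h h' by (auto simp: hist_thru_def)
  have below: "(x, m) \<in> le M" if "x \<in> h" for x
    using history_comparable[OF hh(1) hh(2) that] last[OF that] by (auto simp: lt_def)
  have "h' \<subseteq> h"
  proof
    fix y assume y: "y \<in> h'"
    from history_comparable[OF hh(3) hh(4) y] show "y \<in> h"
    proof
      assume "(m, y) \<in> le M"
      then show ?thesis
        using history_maximal[OF hh(1)] le_trans[OF below] le_in_Tree by blast
    next
      assume "(y, m) \<in> le M"
      then show ?thesis using history_downward[OF hh(1,2)] by blast
    qed
  qed
  moreover have "h \<in> Chains (le M)" using hh by (auto simp: histories_def)
  ultimately show ?thesis using hh(3) unfolding histories_def by blast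
qed

end

section \<open>Soundness\<close>

locale jstit_model =
  fixes M :: "('ag, 'm) jstit"
  assumes model: "is_jstit_model M"
begin

lemma le_order: "partial_order_on (Tree M) (le M)"
  and R_preorder: "preorder_on (Tree M) (R M)"
  and Re_preorder: "preorder_on (Tree M) (Re M)"
  and R_sub_Re: "R M \<subseteq> Re M"
  and le_sub_R: "le M \<subseteq> R M"
  and backward_linear [rule_format]:
    "\<forall>m1 m2 m. (m1, m) \<in> le M \<and> (m2, m) \<in> le M \<longrightarrow> (m1, m2) \<in> le M \<or> (m2, m1) \<in> le M"
  and Choice_partition [rule_format]:
    "\<forall>m \<in> Tree M. \<forall>j. partition_on (hist_thru M m) (Choice M m j)"
  and independence [rule_format]:
    "\<forall>m \<in> Tree M. \<forall>f. (\<forall>j. f j \<in> Choice M m j) \<longrightarrow> (\<Inter>j. f j) \<noteq> {}"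
  and Evid_mono [rule_format]: "\<forall>m m' t. (m, m') \<in> Re M \<longrightarrow> Evid M m t \<subseteq> Evid M m' t"
  and Evid_closed [rule_format]: "\<forall>m \<in> Tree M. \<forall>s t A B.
      ((A \<^bold>\<longrightarrow> B) \<in> Evid M m s \<and> A \<in> Evid M m t \<longrightarrow> B \<in> Evid M m (PTimes s t)) \<and>
      Evid M m s \<union> Evid M m t \<subseteq> Evid M m (PSum s t) \<and>
      (A \<in> Evid M m t \<longrightarrow> (t \<^bold>: A) \<in> Evid M m (PBang t))"
  and Act_mono [rule_format]:
    "\<forall>m m' h. (m', m) \<in> lt M \<and> h \<in> hist_thru M m \<longrightarrow> Act M m' h \<subseteq> Act M m h"
  and Act_undivided [rule_format]:
    "\<forall>m \<in> Tree M. \<forall>h h'. undivided M m h h' \<longrightarrow> Act M m h = Act M m h'"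
  and Act_epistemic [rule_format]: "\<forall>m m'. (m, m') \<in> Re M \<longrightarrow>
      (\<Inter>h \<in> hist_thru M m. Act M m h) \<subseteq> (\<Inter>h' \<in> hist_thru M m'. Act M m' h')"
  by (insert model[unfolded is_jstit_model_def], (elim conjE, assumption)+)

sublocale jstit_tree M
  by unfold_locales (use le_order backward_linear in blast)+

lemma R_refl: "m \<in> Tree M \<Longrightarrow> (m, m) \<in> R M"
  using R_preorder by (auto simp: preorder_on_def refl_on_def)

lemma R_trans: "(x, y) \<in> R M \<Longrightarrow> (y, z) \<in> R M \<Longrightarrow> (x, z) \<in> R M"
  using R_preorder by (auto simp: preorder_on_def dest: transD)

lemma Re_trans: "(x, y) \<in> Re M \<Longrightarrow> (y, z) \<in> Re M \<Longrightarrow> (x, z) \<in> Re M"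
  using Re_preorder by (auto simp: preorder_on_def dest: transD)

lemma Re_in_Tree: "(x, y) \<in> Re M \<Longrightarrow> x \<in> Tree M \<and> y \<in> Tree M"
  using Re_preorder by (auto simp: preorder_on_def)

lemma R_in_Tree: "(x, y) \<in> R M \<Longrightarrow> x \<in> Tree M \<and> y \<in> Tree M"
  using R_sub_Re Re_in_Tree by blast

lemma cell_unique:
  assumes "m \<in> Tree M" "C \<in> Choice M m j" "h \<in> C"
  shows "cell M m j h = C"
  unfolding cell_def
proof (rule the_equality)
  fix D assume "D \<in> Choice M m j \<and> h \<in> D"
  then show "D = C"
    using assms(2,3) disjointD[OF partition_onD2[OF Choice_partition[OF assms(1)]], of D j C] by blast
qed (use assms in blast)

lemma cell_in_Choice:
  assumes "m \<in> Tree M" "h \<in> hist_thru M m"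
  shows "cell M m j h \<in> Choice M m j" "h \<in> cell M m j h"
proof -
  obtain C where "C \<in> Choice M m j" "h \<in> C"
    using partition_onD1[OF Choice_partition[OF assms(1)], of j] assms(2) by blast
  with cell_unique[OF assms(1) this] show "cell M m j h \<in> Choice M m j" "h \<in> cell M m j h"
    by simp_all
qed

lemma cell_sub:
  assumes "m \<in> Tree M" "h \<in> hist_thru M m"
  shows "cell M m j h \<subseteq> hist_thru M m"
  using cell_in_Choice(1)[OF assms, of j] partition_onD1[OF Choice_partition[OF assms(1)], of j]
  by blast

lemma cell_eq:
  assumes "m \<in> Tree M" "h \<in> hist_thru M m" "h' \<in> cell M m j h"
  shows "cell M m j h' = cell M m j h"
  using cell_unique[OF assms(1) cell_in_Choice(1)[OF assms(1,2)] assms(3)] .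

text \<open>Each agent gets a history \<open>g j\<close> witnessing its formula, which is unique as
  the agents are distinct. Independence yields a history in all cells of the \<open>g j\<close>, and
  \<open>Stit j\<close> formulas are constant on cells of \<open>j\<close>.\<close>

lemma A3_sound:
  assumes m: "m \<in> Tree M" and h: "h \<in> hist_thru M m" and jAs: "distinct (map fst jAs)"
    and dia: "\<And>j A. (j, A) \<in> set jAs \<Longrightarrow> \<exists>h'\<in>hist_thru M m. holds M m h' (Stit j A)"
  shows "\<exists>h'\<in>hist_thru M m. \<forall>(j, A)\<in>set jAs. holds M m h' (Stit j A)"
proof -
  have "\<forall>j. \<exists>h'. h' \<in> hist_thru M m \<and> (\<forall>A. (j, A) \<in> set jAs \<longrightarrow> holds M m h' (Stit j A))"
  proof
    fix j show "\<exists>h'. h' \<in> hist_thru M m \<and> (\<forall>A. (j, A) \<in> set jAs \<longrightarrow> holds M m h' (Stit j A))"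
    proof (cases "\<exists>A. (j, A) \<in> set jAs")
      case True
      then obtain A where A: "(j, A) \<in> set jAs" ..
      then have "B = A" if "(j, B) \<in> set jAs" for B
        using eq_key_imp_eq_value[OF jAs] that by blast
      then show ?thesis using dia[OF A] by blast
    qed (use h in blast)
  qed
  from choice[OF this] obtain g where
    "\<forall>j. g j \<in> hist_thru M m \<and> (\<forall>A. (j, A) \<in> set jAs \<longrightarrow> holds M m (g j) (Stit j A))" ..
  then have g: "g j \<in> hist_thru M m" "(j, A) \<in> set jAs \<Longrightarrow> holds M m (g j) (Stit j A)" for j A
    by simp_all
  have "(\<Inter>j. cell M m j (g j)) \<noteq> {}"
    by (rule independence[OF m]) (rule cell_in_Choice(1)[OF m g(1)])
  then obtain h' where "h' \<in> (\<Inter>j. cell M m j (g j))" unfolding ex_in_conv[symmetric] ..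
  then have h': "h' \<in> cell M m j (g j)" for j by blast
  have "h' \<in> hist_thru M m" using h' cell_sub[OF m g(1)] by blast
  moreover have "holds M m h' (Stit j A)" if "(j, A) \<in> set jAs" for j A
    using g(2)[OF that] cell_eq[OF m g(1) h'] by simp
  ultimately show ?thesis by blast
qed

lemma ax_sound:
  "ax A \<Longrightarrow> m \<in> Tree M \<Longrightarrow> h \<in> hist_thru M m \<Longrightarrow> holds M m h A"
proof (induction arbitrary: m h rule: ax.induct)
  case (A0 A)
  then show ?case by (metis tautology_def holds_bool_eval)
next
  case (A1_Stit_T j A)
  then show ?case using cell_in_Choice by auto
next
  case (A1_Stit_4 j A)
  then show ?case using cell_eq by auto
next
  case (A1_Stit_5 j A)
  then show ?case using cell_eq by auto
next
  case (A2 A j)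
  then show ?case using cell_sub[of m h j] by auto
next
  case (A3 jAs)
  show ?case
    using A3_sound[OF A3.prems A3.hyps(2)] A3.hyps(1) by (fastforce simp: holds_Conjs)
next
  case (A4 s A B t)
  then show ?case using Evid_closed[of m A B s t] by auto
next
  case (A5 t A)
  have "holds M m h (PBang t \<^bold>: (t \<^bold>: A))" "holds M m h (Know A)" if "holds M m h (t \<^bold>: A)"
    using that Evid_closed[OF A5(1), of A A t t] Evid_mono[of m _ t] Re_trans[of m] R_sub_Re
    by auto
  then show ?case by (metis holds.simps(2,3))
next
  case (A6 s A t)
  then show ?case using Evid_closed[of m A A s t] by auto
next
  case (A7_T A)
  then show ?case using R_refl by auto
next
  case (A7_4 A)
  then show ?case using R_trans[of m] by auto
next
  case (A8 A)
  then show ?case using R_in_Tree by auto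
next
  case (A9 t)
  have "holds M m' h' (Presented t)"
    if "holds M m h (Box (Presented t))" "(m, m') \<in> R M" "h' \<in> hist_thru M m'" for m' h'
    using that Act_epistemic[of m m'] R_sub_Re by auto
  then have "holds M m h (Box (Presented t)) \<Longrightarrow> holds M m h (Know (Box (Presented t)))"
    by simp
  then show ?case by (metis holds.simps(2,3))
qed auto

text \<open>The semantic content of \<open>R4\<close>: a single \<open>m'\<close> makes all proofs
  presented at \<open>(m, h)\<close> necessary at once, as a disjunction over several terms
  requires.\<close>

lemma presented_becomes_necessary:
  assumes m: "m \<in> Tree M" and h: "h \<in> hist_thru M m"
  obtains m' where "(m, m') \<in> R M" "h \<in> hist_thru M m'"
    "\<And>h'. h' \<in> hist_thru M m' \<Longrightarrow> Act M m h \<subseteq> Act M m' h'"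
proof (cases "\<exists>x\<in>h. (m, x) \<in> lt M")
  case True
  then obtain x where x: "x \<in> h" "(m, x) \<in> lt M" by blast
  then have mx: "(m, x) \<in> le M" by (simp add: lt_def)
  have hx: "h \<in> hist_thru M x" using h x by (simp add: hist_thru_def)
  have "Act M m h \<subseteq> Act M x h'" if h': "h' \<in> hist_thru M x" for h'
  proof -
    have "undivided M m h h'"
      using h h' x hist_thru_antimono[OF mx] by (auto simp: undivided_def hist_thru_def)
    then show ?thesis using Act_undivided[OF m] Act_mono[of m x h'] x(2) h' by blast
  qed
  then show ?thesis using that[of x] le_sub_R mx hx by blast
next
  case False
  then have "h' = h" if "h' \<in> hist_thru M m" for h'
    using last_moment_unique_history[OF h _ that] by blast
  then show ?thesis using that[of m] R_refl[OF m] h by blast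
qed

lemma sound:
  assumes cs: "constant_specification CS" and normal: "normal_for CS M"
  shows "derivable CS A \<Longrightarrow> m \<in> Tree M \<Longrightarrow> h \<in> hist_thru M m \<Longrightarrow> holds M m h A"
proof (induction arbitrary: m h rule: derivable.induct)
  case (Ax A)
  then show ?case by (rule ax_sound)
next
  case (R2 A)
  then show ?case using R_in_Tree by auto
next
  case (R4 ts A)
  show ?case
  proof (rule ccontr)
    assume "\<not> ?thesis"
    then have K: "holds M m h (Know A)" and ts: "set ts \<subseteq> Act M m h"
      using R4.hyps(1) by (auto simp: holds_Disjs)
    obtain m' where m': "(m, m') \<in> R M" "h \<in> hist_thru M m'"
      "\<And>h'. h' \<in> hist_thru M m' \<Longrightarrow> Act M m h \<subseteq> Act M m' h'"
      by (rule presented_becomes_necessary[OF R4.prems]) blast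
    \<comment> \<open>Knowledge persists along \<open>R M\<close>, so the premise of the rule
      applies at \<open>m'\<close> and denies that some term of \<open>ts\<close> is presented in
      all histories there.\<close>
    have "holds M m' h (Know A)" using K R_trans[OF m'(1)] by auto
    with R4.IH[of m' h] m'(2) R_in_Tree[OF m'(1)] obtain t
      where "t \<in> set ts" "\<not> (\<forall>h'\<in>hist_thru M m'. t \<in> Act M m' h')"
      using R4.hyps(1) by (auto simp: holds_Disjs)
    then show False using m'(3) ts by blast
  qed
next
  case (R_CS A)
  \<comment> \<open>Induction on the constants: the inner formula is again in \<open>CS\<close> by
    closure under removing the outermost constant, or is an axiom when no constant remains.\<close>
  have "const_just cs B \<in> CS \<Longrightarrow> cs \<noteq> [] \<Longrightarrow> ax B \<Longrightarrow> m \<in> Tree M \<Longrightarrow> h \<in> hist_thru M m \<Longrightarrow>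
      holds M m h (const_just cs B)" for cs B m h
  proof (induction cs arbitrary: m h)
    case (Cons c cs)
    have "const_just cs B \<in> Evid M m (PConst c)"
      using Cons.prems normal by (auto simp: normal_for_def const_just_def)
    moreover have "holds M m' h' (const_just cs B)"
      if "m' \<in> Tree M" "h' \<in> hist_thru M m'" for m' h'
    proof (cases "cs = []")
      case True
      then show ?thesis using ax_sound[OF Cons.prems(3) that] by (simp add: const_just_def)
    next
      case False
      then have "const_just cs B \<in> CS"
        using cs Cons.prems unfolding constant_specification_def by blast
      then show ?thesis using Cons.IH False Cons.prems(3) that by blast
    qed
    ultimately show ?case using Re_in_Tree by (auto simp: const_just_def)
  qed simp
  then show ?case using R_CS cs unfolding constant_specification_def by blast
qed auto

end

lemma satisfied_imp_consistent:
  assumes "constant_specification CS" "is_jstit_model M" "normal_for CS M" "satisfied_in M \<Gamma>"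
  shows "consistent CS \<Gamma>"
proof
  interpret jstit_model M by (rule jstit_model.intro) (rule assms(2))
  obtain m h where mh: "m \<in> Tree M" "h \<in> hist_thru M m" "\<forall>A\<in>\<Gamma>. holds M m h A"
    using assms(4) by (auto simp: satisfied_in_def MH_def)
  assume "inconsistent CS \<Gamma>"
  then obtain As where As: "As \<noteq> []" "set As \<subseteq> \<Gamma>" "derivable CS (Conjs As \<^bold>\<longrightarrow> \<^bold>\<bottom>)"
    by (auto simp: inconsistent_def)
  from sound[OF assms(1,3) As(3) mh(1,2)] show False
    using As(1,2) mh(3) by (auto simp: holds_Conjs)
qed

text \<open>One moment, one history, no presented proof, and universal evidence, which makes the
  model normal for every \<open>CS\<close>. Its theory later supplies the set without presented
  proofs for the canonical root.\<close>

definition silent_model :: "('ag, unit) jstit" where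
  "silent_model = \<lparr>Tree = UNIV, le = Id, Choice = (\<lambda>m j. {{UNIV}}), Act = (\<lambda>m h. {}), R = Id, Re = Id,
     Evid = (\<lambda>m t. UNIV), Val = (\<lambda>p. {})\<rparr>"

lemma silent_histories: "hist_thru silent_model m = {UNIV}"
proof -
  have "Chains (Id :: unit rel) = UNIV" by (auto simp: Chains_def)
  then show ?thesis by (auto simp: hist_thru_def histories_def silent_model_def)
qed

lemma silent_model: "is_jstit_model silent_model"
proof -
  have u: "\<not> undivided silent_model m h h'" for m h h'
    by (auto simp: undivided_def lt_def silent_model_def)
  show ?thesis
    unfolding is_jstit_model_def
    by (simp add: u silent_histories)
      (auto simp: silent_model_def partial_order_on_def preorder_on_def refl_on_def trans_def
        antisym_def partition_on_def lt_def)
qed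

section \<open>Maximal consistent sets\<close>

text \<open>Unlike \<open>Conjs\<close>, iterated implication is meaningful for the empty
  list.\<close>

definition imps :: "'ag form list \<Rightarrow> 'ag form \<Rightarrow> 'ag form" where
  "imps As B = foldr (\<lambda>A C. A \<^bold>\<longrightarrow> C) As B"

lemma bool_eval_imps [simp]:
  "bool_eval v (imps As B) \<longleftrightarrow> ((\<forall>A\<in>set As. bool_eval v A) \<longrightarrow> bool_eval v B)"
  by (induction As) (auto simp: imps_def)

locale jstit_logic =
  fixes CS :: "'ag::finite form set"
begin

abbreviation deriv :: "'ag form \<Rightarrow> bool"  ("\<turnstile> _" [60] 60) where
  "\<turnstile> A \<equiv> derivable CS A"

lemma derivable_imps_mp: "\<turnstile> imps As B \<Longrightarrow> \<forall>A\<in>set As. \<turnstile> A \<Longrightarrow> \<turnstile> B"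
  by (induction As) (auto simp: imps_def intro: derivable.R1)

text \<open>Reduces propositional reasoning inside the calculus to truth tables:
  \<open>imps As B\<close> is a tautology, and modus ponens removes its derivable premises.\<close>

lemma derivable_bool:
  assumes "\<forall>A\<in>set As. \<turnstile> A" and "\<And>v. \<forall>A\<in>set As. bool_eval v A \<Longrightarrow> bool_eval v B"
  shows "\<turnstile> B"
proof (rule derivable_imps_mp[OF _ assms(1)])
  have "tautology (imps As B)" using assms(2) by (simp add: tautology_def)
  then show "\<turnstile> imps As B" by (intro derivable.Ax ax.A0)
qed

definition con :: "'ag form set \<Rightarrow> bool" where
  "con S \<longleftrightarrow> (\<forall>As. set As \<subseteq> S \<longrightarrow> \<not> (\<turnstile> imps As \<^bold>\<bottom>))"

definition mcs :: "'ag form set \<Rightarrow> bool" where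
  "mcs \<Delta> \<longleftrightarrow> con \<Delta> \<and> (\<forall>S. \<Delta> \<subseteq> S \<longrightarrow> con S \<longrightarrow> S = \<Delta>)"

lemma con_mono: "con S \<Longrightarrow> T \<subseteq> S \<Longrightarrow> con T"
  unfolding con_def by (meson subset_trans)

text \<open>Zorn's lemma below a bound \<open>U\<close>: the bound is \<open>UNIV\<close> for
  Lindenbaum's lemma, and a restricted set of formulas when the necessarily presented proofs are
  maximised.\<close>

lemma maximal_con_within:
  assumes "con S" "S \<subseteq> U"
  obtains T where "S \<subseteq> T" "T \<subseteq> U" "con T" "\<And>T'. T \<subseteq> T' \<Longrightarrow> T' \<subseteq> U \<Longrightarrow> con T' \<Longrightarrow> T' = T"
proof -
  let ?X = "{T. S \<subseteq> T \<and> T \<subseteq> U \<and> con T}"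
  have "\<exists>T\<in>?X. \<forall>X\<in>?X. T \<subseteq> X \<longrightarrow> X = T"
  proof (rule subset_Zorn_nonempty)
    show "?X \<noteq> {}" using assms by blast
    fix \<C> assume ne: "\<C> \<noteq> {}" and ch: "subset.chain ?X \<C>"
    have sub: "\<C> \<subseteq> ?X" using ch by (auto simp: subset.chain_def)
    have "con (\<Union>\<C>)"
      unfolding con_def
    proof (intro allI impI)
      fix As assume "set As \<subseteq> \<Union>\<C>"
      then obtain T where "T \<in> \<C>" "set As \<subseteq> T"
        by (meson List.finite_set finite_subset_Union_chain ne ch)
      then show "\<not> (\<turnstile> imps As \<^bold>\<bottom>)" using sub unfolding con_def by blast
    qed
    then show "\<Union>\<C> \<in> ?X" using ne sub by blast
  qed
  then obtain T where T: "T \<in> ?X" "\<forall>X\<in>?X. T \<subseteq> X \<longrightarrow> X = T" ..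
  show thesis
  proof (rule that[of T])
    fix T' assume T': "T \<subseteq> T'" "T' \<subseteq> U" "con T'"
    with T(1) have "T' \<in> ?X" by auto
    then show "T' = T" using T(2) T'(1) by simp
  qed (use T(1) in auto)
qed

lemma Lindenbaum:
  assumes "con S"
  obtains \<Delta> where "mcs \<Delta>" "S \<subseteq> \<Delta>"
proof -
  obtain T where "S \<subseteq> T" "con T" "\<And>T'. T \<subseteq> T' \<Longrightarrow> T' \<subseteq> UNIV \<Longrightarrow> con T' \<Longrightarrow> T' = T"
    using maximal_con_within[OF assms subset_UNIV] by metis
  then show thesis using that[of T] by (simp add: mcs_def)
qed

lemma mcs_imp_con: "mcs \<Delta> \<Longrightarrow> con \<Delta>"
  by (simp add: mcs_def)

text \<open>A refutation that uses \<open>B\<close> becomes one from \<open>As\<close> and the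
  remaining premises, so adding \<open>B\<close> preserves consistency, and maximality gives
  \<open>B\<close>.\<close>

lemma mcs_deduct:
  assumes \<Delta>: "mcs \<Delta>" and As: "set As \<subseteq> \<Delta>" and B: "\<turnstile> imps As B"
  shows "B \<in> \<Delta>"
proof -
  have "con (insert B \<Delta>)"
    unfolding con_def
  proof (intro allI impI notI)
    fix Bs assume Bs: "set Bs \<subseteq> insert B \<Delta>" "\<turnstile> imps Bs \<^bold>\<bottom>"
    let ?Cs = "As @ filter (\<lambda>A. A \<noteq> B) Bs"
    have "\<turnstile> imps ?Cs \<^bold>\<bottom>"
      by (rule derivable_bool[of "[imps As B, imps Bs \<^bold>\<bottom>]"]) (use B Bs(2) in auto)
    moreover have "set ?Cs \<subseteq> \<Delta>" using As Bs(1) by auto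
    ultimately show False using \<Delta> unfolding mcs_def con_def by blast
  qed
  then show ?thesis using \<Delta> unfolding mcs_def by blast
qed

lemma mcs_derivable: "mcs \<Delta> \<Longrightarrow> \<turnstile> A \<Longrightarrow> A \<in> \<Delta>"
  using mcs_deduct[of \<Delta> "[]" A] by (simp add: imps_def)

lemma mcs_ax: "mcs \<Delta> \<Longrightarrow> ax A \<Longrightarrow> A \<in> \<Delta>"
  using mcs_derivable derivable.Ax by blast

lemma mcs_Neg [simp]:
  assumes \<Delta>: "mcs \<Delta>"
  shows "(\<^bold>\<not> A) \<in> \<Delta> \<longleftrightarrow> A \<notin> \<Delta>"
proof
  assume "(\<^bold>\<not> A) \<in> \<Delta>"
  moreover have "\<turnstile> imps [A, \<^bold>\<not> A] \<^bold>\<bottom>"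
    by (rule derivable_bool[of "[]"]) auto
  ultimately show "A \<notin> \<Delta>"
    using \<Delta> unfolding mcs_def con_def by (metis empty_set empty_subsetI insert_subset list.simps(15))
next
  assume A: "A \<notin> \<Delta>"
  then have "\<not> con (insert A \<Delta>)" using \<Delta> unfolding mcs_def by blast
  then obtain Bs where Bs: "set Bs \<subseteq> insert A \<Delta>" "\<turnstile> imps Bs \<^bold>\<bottom>"
    unfolding con_def by blast
  have "\<turnstile> imps (filter (\<lambda>B. B \<noteq> A) Bs) (\<^bold>\<not> A)"
    by (rule derivable_bool[of "[imps Bs \<^bold>\<bottom>]"]) (use Bs(2) in auto)
  then show "(\<^bold>\<not> A) \<in> \<Delta>" by (rule mcs_deduct[OF \<Delta>, rotated]) (use Bs(1) in auto)
qed

lemma mcs_Conj [simp]: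
  assumes \<Delta>: "mcs \<Delta>"
  shows "(A \<^bold>\<and> B) \<in> \<Delta> \<longleftrightarrow> A \<in> \<Delta> \<and> B \<in> \<Delta>"
proof -
  have d: "\<turnstile> imps [A \<^bold>\<and> B] A" "\<turnstile> imps [A \<^bold>\<and> B] B" "\<turnstile> imps [A, B] (A \<^bold>\<and> B)"
    by (rule derivable_bool[of "[]"]; simp)+
  show ?thesis
    using mcs_deduct[OF \<Delta> _ d(1)] mcs_deduct[OF \<Delta> _ d(2)] mcs_deduct[OF \<Delta> _ d(3)] by fastforce
qed

lemma mcs_bool_eval: "mcs \<Delta> \<Longrightarrow> bool_eval (\<lambda>A. A \<in> \<Delta>) A \<longleftrightarrow> A \<in> \<Delta>"
  by (induction A) auto

lemma mcs_Conjs: "mcs \<Delta> \<Longrightarrow> As \<noteq> [] \<Longrightarrow> Conjs As \<in> \<Delta> \<longleftrightarrow> set As \<subseteq> \<Delta>"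
  using bool_eval_Conjs[of As "\<lambda>A. A \<in> \<Delta>"] by (auto simp: mcs_bool_eval)

lemma mcs_Disjs: "mcs \<Delta> \<Longrightarrow> As \<noteq> [] \<Longrightarrow> Disjs As \<in> \<Delta> \<longleftrightarrow> (\<exists>A\<in>set As. A \<in> \<Delta>)"
  using bool_eval_Disjs[of As "\<lambda>A. A \<in> \<Delta>"] by (simp add: mcs_bool_eval)

lemma mcs_mp: "mcs \<Delta> \<Longrightarrow> \<turnstile> (A \<^bold>\<longrightarrow> B) \<Longrightarrow> A \<in> \<Delta> \<Longrightarrow> B \<in> \<Delta>"
  using mcs_derivable[of \<Delta> "A \<^bold>\<longrightarrow> B"] by simp

text \<open>An underivable formula has a consistent negation. Derivability, which defines the
  evidence at the canonical root, can thus be handled like membership in a maximal consistent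
  set.\<close>

lemma derivable_iff_all_mcs: "\<turnstile> A \<longleftrightarrow> (\<forall>\<Delta>. mcs \<Delta> \<longrightarrow> A \<in> \<Delta>)"
proof (intro iffI allI impI)
  assume all: "\<forall>\<Delta>. mcs \<Delta> \<longrightarrow> A \<in> \<Delta>"
  show "\<turnstile> A"
  proof (rule ccontr)
    assume nd: "\<not> (\<turnstile> A)"
    have "con {\<^bold>\<not> A}"
      unfolding con_def
    proof (intro allI impI notI)
      fix As assume As: "set As \<subseteq> {\<^bold>\<not> A}" "\<turnstile> imps As \<^bold>\<bottom>"
      have "\<turnstile> A" by (rule derivable_bool[of "[imps As \<^bold>\<bottom>]"]) (use As in auto)
      with nd show False ..
    qed
    then obtain \<Delta> where "mcs \<Delta>" "{\<^bold>\<not> A} \<subseteq> \<Delta>" by (rule Lindenbaum)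
    with all show False by auto
  qed
qed (simp add: mcs_derivable)

section \<open>Modal reasoning\<close>

definition normal_modality :: "('ag form \<Rightarrow> 'ag form) \<Rightarrow> bool" where
  "normal_modality f \<longleftrightarrow> (\<forall>A. (\<turnstile> A) \<longrightarrow> (\<turnstile> f A)) \<and> (\<forall>A B. \<turnstile> (f (A \<^bold>\<longrightarrow> B) \<^bold>\<longrightarrow> (f A \<^bold>\<longrightarrow> f B)))"

lemma normal_modality_imps:
  assumes f: "normal_modality f" and "\<turnstile> imps As B"
  shows "\<turnstile> imps (map f As) (f B)"
proof -
  have "\<turnstile> (f (imps As B) \<^bold>\<longrightarrow> imps (map f As) (f B))"
  proof (induction As)
    case Nil
    show ?case by (rule derivable_bool[of "[]"]) (auto simp: imps_def)
  next
    case (Cons A As)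
    have "\<turnstile> (f (A \<^bold>\<longrightarrow> imps As B) \<^bold>\<longrightarrow> (f A \<^bold>\<longrightarrow> f (imps As B)))"
      using f by (simp add: normal_modality_def)
    moreover have "imps (A # As) B = (A \<^bold>\<longrightarrow> imps As B)" by (simp add: imps_def)
    ultimately show ?case
      by (intro derivable_bool[of "[f (A \<^bold>\<longrightarrow> imps As B) \<^bold>\<longrightarrow> (f A \<^bold>\<longrightarrow> f (imps As B)),
          f (imps As B) \<^bold>\<longrightarrow> imps (map f As) (f B)]"]) (use Cons.IH in auto)
  qed
  then show ?thesis
    using f assms(2) derivable.R1 unfolding normal_modality_def by blast
qed

lemma normal_modality_mono:
  assumes "normal_modality f" "\<turnstile> (A \<^bold>\<longrightarrow> B)"
  shows "\<turnstile> (f A \<^bold>\<longrightarrow> f B)"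
  using normal_modality_imps[of f "[A]" B] assms by (simp add: imps_def)

lemma mcs_normal_modality_imps:
  assumes "mcs \<Delta>" "normal_modality f" "\<turnstile> imps As B" "\<And>A. A \<in> set As \<Longrightarrow> f A \<in> \<Delta>"
  shows "f B \<in> \<Delta>"
  using mcs_deduct[OF assms(1) _ normal_modality_imps[OF assms(2,3)]] assms(4) by auto

text \<open>The existence lemma for a normal modality: if the negation of \<open>A\<close>
  contradicted the formulas under \<open>f\<close>, normality would put \<open>f A\<close> into
  \<open>\<Delta>\<close>.\<close>

lemma mcs_successor:
  assumes \<Delta>: "mcs \<Delta>" and f: "normal_modality f" and A: "f A \<notin> \<Delta>"
  obtains \<Delta>' where "mcs \<Delta>'" "\<And>B. f B \<in> \<Delta> \<Longrightarrow> B \<in> \<Delta>'" "A \<notin> \<Delta>'"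
proof -
  have "con (insert (\<^bold>\<not> A) {B. f B \<in> \<Delta>})"
    unfolding con_def
  proof (intro allI impI notI)
    fix As assume As: "set As \<subseteq> insert (\<^bold>\<not> A) {B. f B \<in> \<Delta>}" "\<turnstile> imps As \<^bold>\<bottom>"
    have "\<turnstile> imps (filter (\<lambda>B. B \<noteq> (\<^bold>\<not> A)) As) A"
      by (rule derivable_bool[of "[imps As \<^bold>\<bottom>]"]) (use As(2) in auto)
    from mcs_normal_modality_imps[OF \<Delta> f this] have "f A \<in> \<Delta>" using As(1) by auto
    with A show False ..
  qed
  then obtain \<Delta>' where "mcs \<Delta>'" "insert (\<^bold>\<not> A) {B. f B \<in> \<Delta>} \<subseteq> \<Delta>'" by (rule Lindenbaum)
  then show thesis by (intro that[of \<Delta>']) auto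
qed

lemma normal_Know: "normal_modality Know"
  by (simp add: normal_modality_def derivable.R2 derivable.Ax ax.A7_K)

text \<open>Necessitation for \<open>Box\<close> is derived: \<open>R2\<close> gives
  \<open>Know A\<close>, \<open>A8\<close> gives \<open>Box (Know (Box A))\<close>, and reflexivity
  strips the two outer modalities.\<close>

lemma Box_necessitation: "\<turnstile> A \<Longrightarrow> \<turnstile> Box A"
proof -
  assume "\<turnstile> A"
  then have "\<turnstile> Box (Know (Box A))"
    using derivable.R1[OF derivable.Ax[OF ax.A8] derivable.R2] by blast
  then show ?thesis
    using derivable.R1[OF derivable.Ax[OF ax.A1_Box_T]] derivable.R1[OF derivable.Ax[OF ax.A7_T]]
    by blast
qed

lemma normal_Box: "normal_modality Box"
  by (simp add: normal_modality_def Box_necessitation derivable.Ax ax.A1_Box_K)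

lemma normal_Stit: "normal_modality (Stit j)"
  using derivable.R1[OF derivable.Ax[OF ax.A2] Box_necessitation]
  by (simp add: normal_modality_def derivable.Ax ax.A1_Stit_K)

lemma mcs_BoxD: "mcs \<Delta> \<Longrightarrow> Box A \<in> \<Delta> \<Longrightarrow> A \<in> \<Delta>"
  using mcs_mp[OF _ derivable.Ax[OF ax.A1_Box_T]] .

lemma mcs_StitD: "mcs \<Delta> \<Longrightarrow> Stit j A \<in> \<Delta> \<Longrightarrow> A \<in> \<Delta>"
  using mcs_mp[OF _ derivable.Ax[OF ax.A1_Stit_T]] .

lemma mcs_KnowD: "mcs \<Delta> \<Longrightarrow> Know A \<in> \<Delta> \<Longrightarrow> A \<in> \<Delta>"
  using mcs_mp[OF _ derivable.Ax[OF ax.A7_T]] .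

lemma mcs_Know_Know: "mcs \<Delta> \<Longrightarrow> Know A \<in> \<Delta> \<Longrightarrow> Know (Know A) \<in> \<Delta>"
  using mcs_mp[OF _ derivable.Ax[OF ax.A7_4]] .

text \<open>\<open>A8\<close> with its inner \<open>Box\<close> dropped. Hence knowledge is the same
  throughout a \<open>Box\<close>-class.\<close>

lemma mcs_Box_Know: "mcs \<Delta> \<Longrightarrow> Know A \<in> \<Delta> \<Longrightarrow> Box (Know A) \<in> \<Delta>"
proof -
  assume \<Delta>: "mcs \<Delta>" "Know A \<in> \<Delta>"
  have "\<turnstile> (Box (Know (Box A)) \<^bold>\<longrightarrow> Box (Know A))"
    using normal_modality_mono[OF normal_Box normal_modality_mono[OF normal_Know
        derivable.Ax[OF ax.A1_Box_T]]] .
  then show ?thesis using mcs_mp[OF \<Delta>(1) derivable.Ax[OF ax.A8] \<Delta>(2)] mcs_mp[OF \<Delta>(1)] by blast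
qed

lemma mcs_Know_Box_Presented:
  "mcs \<Delta> \<Longrightarrow> Box (Presented t) \<in> \<Delta> \<Longrightarrow> Know (Box (Presented t)) \<in> \<Delta>"
  using mcs_mp[OF _ derivable.Ax[OF ax.A9]] .

lemma mcs_Just_Bang: "mcs \<Delta> \<Longrightarrow> t \<^bold>: A \<in> \<Delta> \<Longrightarrow> PBang t \<^bold>: (t \<^bold>: A) \<in> \<Delta>"
  and mcs_Just_Know: "mcs \<Delta> \<Longrightarrow> t \<^bold>: A \<in> \<Delta> \<Longrightarrow> Know A \<in> \<Delta>"
  using mcs_mp[OF _ derivable.Ax[OF ax.A5[of t A]]] by simp_all

text \<open>By \<open>A5\<close> the justification is itself justified by \<open>PBang t\<close>,
  and what is justified is known.\<close>

lemma mcs_Know_Just: "mcs \<Delta> \<Longrightarrow> t \<^bold>: A \<in> \<Delta> \<Longrightarrow> Know (t \<^bold>: A) \<in> \<Delta>"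
  using mcs_Just_Bang mcs_Just_Know by blast

section \<open>Classes of maximal consistent sets and independence of agents\<close>

definition Box_eq :: "'ag form set \<Rightarrow> 'ag form set \<Rightarrow> bool" where
  "Box_eq \<Delta> \<Delta>' \<longleftrightarrow> (\<forall>A. Box A \<in> \<Delta> \<longleftrightarrow> Box A \<in> \<Delta>')"

definition Stit_eq :: "'ag \<Rightarrow> 'ag form set \<Rightarrow> 'ag form set \<Rightarrow> bool" where
  "Stit_eq j \<Delta> \<Delta>' \<longleftrightarrow> (\<forall>A. Stit j A \<in> \<Delta> \<longleftrightarrow> Stit j A \<in> \<Delta>')"

text \<open>One direction suffices in S5: \<open>A1_Box_4\<close> transports boxed formulas and
  \<open>A1_Box_5\<close> their negations.\<close>

lemma Box_eqI:
  assumes \<Delta>: "mcs \<Delta>" "mcs \<Delta>'" and sub: "\<And>A. Box A \<in> \<Delta> \<Longrightarrow> A \<in> \<Delta>'"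
  shows "Box_eq \<Delta> \<Delta>'"
  unfolding Box_eq_def
  using mcs_mp[OF \<Delta>(1) derivable.Ax[OF ax.A1_Box_4]] mcs_mp[OF \<Delta>(1) derivable.Ax[OF ax.A1_Box_5]]
    sub mcs_Neg[OF \<Delta>(1)] mcs_Neg[OF \<Delta>(2)] by blast

lemma Stit_eqI:
  assumes \<Delta>: "mcs \<Delta>" "mcs \<Delta>'" and sub: "\<And>A. Stit j A \<in> \<Delta> \<Longrightarrow> A \<in> \<Delta>'"
  shows "Stit_eq j \<Delta> \<Delta>'"
  unfolding Stit_eq_def
  using mcs_mp[OF \<Delta>(1) derivable.Ax[OF ax.A1_Stit_4]] mcs_mp[OF \<Delta>(1) derivable.Ax[OF ax.A1_Stit_5]]
    sub mcs_Neg[OF \<Delta>(1)] mcs_Neg[OF \<Delta>(2)] by blast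

lemma Stit_eq_imp_Box_eq:
  assumes \<Delta>: "mcs \<Delta>" "mcs \<Delta>'" and eq: "Stit_eq j \<Delta> \<Delta>'"
  shows "Box_eq \<Delta> \<Delta>'"
proof (rule Box_eqI[OF \<Delta>])
  fix A assume "Box A \<in> \<Delta>"
  then have "Stit j A \<in> \<Delta>" using mcs_mp[OF \<Delta>(1) derivable.Ax[OF ax.A2]] by blast
  then show "A \<in> \<Delta>'" using eq mcs_StitD[OF \<Delta>(2)] by (simp add: Stit_eq_def)
qed

lemma Box_eq_refl [simp]: "Box_eq \<Delta> \<Delta>"
  and Box_eq_trans: "Box_eq \<Delta> \<Delta>' \<Longrightarrow> Box_eq \<Delta>' \<Delta>'' \<Longrightarrow> Box_eq \<Delta> \<Delta>''"
  by (simp_all add: Box_eq_def)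

lemma Box_eq_Know: "mcs \<Delta> \<Longrightarrow> mcs \<Delta>' \<Longrightarrow> Box_eq \<Delta> \<Delta>' \<Longrightarrow> Know A \<in> \<Delta> \<longleftrightarrow> Know A \<in> \<Delta>'"
  using mcs_Box_Know mcs_BoxD by (metis Box_eq_def)

lemma Box_eq_Just: "mcs \<Delta> \<Longrightarrow> mcs \<Delta>' \<Longrightarrow> Box_eq \<Delta> \<Delta>' \<Longrightarrow> t \<^bold>: A \<in> \<Delta> \<longleftrightarrow> t \<^bold>: A \<in> \<Delta>'"
  using mcs_Know_Just mcs_KnowD Box_eq_Know by blast

lemma finite_preimage_list:
  assumes "inj f"
  obtains Bs where "set Bs = {B. f B \<in> set As}"
  using finite_list[OF finite_vimageI[OF finite_set assms, of As]] by (auto simp: vimage_def)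

text \<open>The syntactic form of independence. In a finite refutation the formulas of each agent
  merge into one \<open>C j\<close>; as there are finitely many agents, \<open>A3\<close> applies to
  all of them together and yields a maximal consistent set containing every premise.\<close>

lemma mcs_independence:
  assumes \<Gamma>: "mcs \<Gamma>" and \<Delta>: "\<And>j. mcs (\<Delta> j)" "\<And>j. Box_eq \<Gamma> (\<Delta> j)"
  obtains \<Theta> where "mcs \<Theta>" "\<And>j. Stit_eq j (\<Delta> j) \<Theta>"
proof -
  have "con (\<Union>j. {Stit j A | A. Stit j A \<in> \<Delta> j})"
    unfolding con_def
  proof (intro allI impI notI)
    fix As assume As: "set As \<subseteq> (\<Union>j. {Stit j A | A. Stit j A \<in> \<Delta> j})" "\<turnstile> imps As \<^bold>\<bottom>"
    have "\<forall>j. \<exists>Bs. set Bs = {B. Stit j B \<in> set As}"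
      by (metis finite_preimage_list form.inject(4) injI)
    from choice[OF this] obtain Bs where Bs: "\<forall>j. set (Bs j) = {B. Stit j B \<in> set As}" ..
    \<comment> \<open>The extra true conjunct keeps the conjunction nonempty for agents without
      formulas in \<open>As\<close>.\<close>
    define C where "C j = Conjs ((\<^bold>\<not> \<^bold>\<bottom>) # Bs j)" for j
    obtain js :: "'ag list" where js: "set js = UNIV" "distinct js"
      using finite_distinct_list[OF finite_UNIV] by blast
    define jCs where "jCs = map (\<lambda>j. (j, C j)) js"
    have jCs: "jCs \<noteq> []" "distinct (map fst jCs)"
      using js by (auto simp: jCs_def comp_def)
    have "Dia (Stit j (C j)) \<in> \<Gamma>" for j
    proof -
      have "\<turnstile> imps (Bs j) (C j)"
        by (rule derivable_bool[of "[]"]) (auto simp: C_def bool_eval_Conjs)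
      then have "Stit j (C j) \<in> \<Delta> j"
        by (rule mcs_normal_modality_imps[OF \<Delta>(1) normal_Stit]) (use Bs As(1) in auto)
      then have "Box (\<^bold>\<not> Stit j (C j)) \<notin> \<Delta> j" using mcs_BoxD[OF \<Delta>(1)] mcs_Neg[OF \<Delta>(1)] by blast
      then show ?thesis using \<Delta>(2)[of j] \<Gamma> by (simp add: Box_eq_def)
    qed
    then have "Conjs (map (\<lambda>(j, A). Dia (Stit j A)) jCs) \<in> \<Gamma>"
      using jCs(1) \<Gamma> by (auto simp: mcs_Conjs jCs_def)
    then have "Dia (Conjs (map (\<lambda>(j, A). Stit j A) jCs)) \<in> \<Gamma>"
      by (rule mcs_mp[OF \<Gamma> derivable.Ax[OF ax.A3[OF jCs]]])
    then have "Box (\<^bold>\<not> Conjs (map (\<lambda>(j, A). Stit j A) jCs)) \<notin> \<Gamma>" using \<Gamma> by simp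
    from mcs_successor[OF \<Gamma> normal_Box this] obtain \<Theta>
      where \<Theta>: "mcs \<Theta>" "(\<^bold>\<not> Conjs (map (\<lambda>(j, A). Stit j A) jCs)) \<notin> \<Theta>" by blast
    then have "Stit j (C j) \<in> \<Theta>" for j
      using jCs(1) js(1) by (auto simp: mcs_Conjs jCs_def)
    moreover have "\<turnstile> (C j \<^bold>\<longrightarrow> B)" if "B \<in> set (Bs j)" for j B
      by (rule derivable_bool[of "[]"]) (use that in \<open>auto simp: C_def bool_eval_Conjs\<close>)
    ultimately have "Stit j B \<in> \<Theta>" if "B \<in> set (Bs j)" for j B
      using mcs_mp[OF \<Theta>(1) normal_modality_mono[OF normal_Stit]] that by blast
    then have "set As \<subseteq> \<Theta>" using As(1) Bs by auto
    then show False using mcs_imp_con[OF \<Theta>(1)] As(2) by (simp add: con_def)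
  qed
  then obtain \<Theta> where \<Theta>: "mcs \<Theta>" "(\<Union>j. {Stit j A | A. Stit j A \<in> \<Delta> j}) \<subseteq> \<Theta>"
    by (rule Lindenbaum)
  have "Stit_eq j (\<Delta> j) \<Theta>" for j
    by (rule Stit_eqI[OF \<Delta>(1) \<Theta>(1)]) (use \<Theta>(2) mcs_StitD[OF \<Theta>(1)] in blast)
  then show thesis using that \<Theta>(1) by blast
qed

section \<open>Presented proofs\<close>

text \<open>The known premises of a refutation merge into one \<open>A\<close>, and
  \<open>Know A\<close> then implies that some \<open>Box (Presented t)\<close> fails.
  \<open>R4\<close> removes the boxes, so some \<open>Presented t\<close> would be missing from
  \<open>\<Delta>\<close>.\<close>

lemma con_future:
  assumes \<Delta>: "mcs \<Delta>"
  shows "con ({Know A | A. Know A \<in> \<Delta>} \<union> {Box (Presented t) | t. Presented t \<in> \<Delta>})" (is "con (?K \<union> ?E)")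
  unfolding con_def
proof (intro allI impI notI)
  fix As assume As: "set As \<subseteq> ?K \<union> ?E" "\<turnstile> imps As \<^bold>\<bottom>"
  obtain Bs where Bs: "set Bs = {B. Know B \<in> set As}"
    by (rule finite_preimage_list[of Know]) (auto intro: injI)
  obtain ts where ts: "set ts = {t. Box (Presented t) \<in> set As}"
    by (rule finite_preimage_list[of "\<lambda>t. Box (Presented t)"]) (auto intro: injI)
  show False
  proof (cases "ts = []")
    \<comment> \<open>\<open>R4\<close> needs a nonempty list; without boxed terms all premises lie
      in \<open>\<Delta>\<close> itself.\<close>
    case True
    then have "set As \<subseteq> \<Delta>" using As(1) ts by auto
    then show False using mcs_imp_con[OF \<Delta>] As(2) by (simp add: con_def)
  next
    case False
    define A where "A = Conjs ((\<^bold>\<not> \<^bold>\<bottom>) # Bs)"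
    have "\<turnstile> imps Bs A"
      by (rule derivable_bool[of "[]"]) (auto simp: A_def bool_eval_Conjs)
    then have A: "Know A \<in> \<Delta>"
      by (rule mcs_normal_modality_imps[OF \<Delta> normal_Know]) (use Bs As(1) in auto)
    have "\<turnstile> (Know A \<^bold>\<longrightarrow> Know B)" if "B \<in> set Bs" for B
      by (rule normal_modality_mono[OF normal_Know derivable_bool[of "[]"]])
        (use that in \<open>auto simp: A_def bool_eval_Conjs\<close>)
    then have hyps: "\<forall>C\<in>set (imps As \<^bold>\<bottom> # map (\<lambda>B. Know A \<^bold>\<longrightarrow> Know B) Bs). \<turnstile> C"
      using As(2) by simp
    have "\<turnstile> (Know A \<^bold>\<longrightarrow> Disjs (map (\<lambda>t. \<^bold>\<not> Box (Presented t)) ts))"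
    proof (rule derivable_bool[OF hyps])
      fix v assume v: "\<forall>C\<in>set (imps As \<^bold>\<bottom> # map (\<lambda>B. Know A \<^bold>\<longrightarrow> Know B) Bs). bool_eval v C"
      then obtain C where C: "C \<in> set As" "\<not> bool_eval v C" by auto
      from As(1) C(1) have "C \<in> ?K \<union> ?E" by blast
      then show "bool_eval v (Know A \<^bold>\<longrightarrow> Disjs (map (\<lambda>t. \<^bold>\<not> Box (Presented t)) ts))"
      proof
        assume "C \<in> ?K"
        then obtain B where "C = Know B" by blast
        then show ?thesis using C v Bs by auto
      next
        assume "C \<in> ?E"
        then obtain t where "C = Box (Presented t)" by blast
        then show ?thesis using C ts False by (auto simp: bool_eval_Disjs)
      qed
    qed
    then have "Disjs (map (\<lambda>t. \<^bold>\<not> Presented t) ts) \<in> \<Delta>"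
      using mcs_mp[OF \<Delta> derivable.R4[OF False] A] by blast
    then show False using \<Delta> False As(1) ts by (auto simp: mcs_Disjs)
  qed
qed

definition follows :: "'ag form set \<Rightarrow> 'ag form set \<Rightarrow> bool" where
  "follows \<Delta> \<Theta> \<longleftrightarrow> (\<forall>A. Know A \<in> \<Delta> \<longrightarrow> Know A \<in> \<Theta>) \<and>
     (\<forall>t. Presented t \<in> \<Delta> \<longrightarrow> Box (Presented t) \<in> \<Theta>)"

text \<open>Maximising the set of necessarily presented proofs among the futures of \<open>\<Delta>\<close> makes the future
  its own successor.\<close>

lemma stable_future_exists:
  assumes \<Delta>: "mcs \<Delta>"
  shows "\<exists>\<Theta>. mcs \<Theta> \<and> follows \<Delta> \<Theta> \<and> follows \<Theta> \<Theta>"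
proof -
  let ?F = "\<lambda>\<Delta>. {Know A | A. Know A \<in> \<Delta>} \<union> {Box (Presented t) | t. Presented t \<in> \<Delta>}"
  let ?U = "{Know A | A. Know A \<in> \<Delta>} \<union> range (\<lambda>t. Box (Presented t))"
  have "?F \<Delta> \<subseteq> ?U" by auto
  then obtain T
    where T: "?F \<Delta> \<subseteq> T" "T \<subseteq> ?U" "con T" and
      max: "\<And>T'. T \<subseteq> T' \<Longrightarrow> T' \<subseteq> ?U \<Longrightarrow> con T' \<Longrightarrow> T' = T"
    by (rule maximal_con_within[OF con_future[OF \<Delta>]]) blast
  obtain \<Theta> where \<Theta>: "mcs \<Theta>" "T \<subseteq> \<Theta>" by (rule Lindenbaum[OF T(3)])
  have "Box (Presented t) \<in> \<Theta>" if "Presented t \<in> \<Theta>" for t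
  proof -
    \<comment> \<open>Since \<open>Box (Presented t)\<close> in \<open>\<Theta>\<close> gives
      \<open>Presented t\<close> there, \<open>con_future\<close> for \<open>\<Theta>\<close> covers
      \<open>T\<close> together with the new boxed formula, and maximality of \<open>T\<close>
      absorbs it.\<close>
    have "T \<subseteq> ?F \<Theta>"
    proof
      fix B assume "B \<in> T"
      then have "B \<in> ?U" "B \<in> \<Theta>" using T(2) \<Theta>(2) by auto
      then show "B \<in> ?F \<Theta>" using mcs_BoxD[OF \<Theta>(1)] by auto
    qed
    then have "insert (Box (Presented t)) T \<subseteq> ?F \<Theta>" using that by auto
    then have "con (insert (Box (Presented t)) T)" using con_mono[OF con_future[OF \<Theta>(1)]] by blast
    then have "insert (Box (Presented t)) T = T" by (intro max) (use T(2) in auto)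
    then show ?thesis using \<Theta>(2) by auto
  qed
  moreover have "follows \<Delta> \<Theta>" using T(1) \<Theta>(2) by (auto simp: follows_def)
  ultimately show ?thesis using \<Theta>(1) by (auto simp: follows_def)
qed

definition future :: "'ag form set \<Rightarrow> 'ag form set" where
  "future \<Delta> = (SOME \<Theta>. mcs \<Theta> \<and> follows \<Delta> \<Theta> \<and> follows \<Theta> \<Theta>)"

lemma future:
  assumes "mcs \<Delta>"
  shows "mcs (future \<Delta>)" "follows \<Delta> (future \<Delta>)" "follows (future \<Delta>) (future \<Delta>)"
  using someI_ex[OF stable_future_exists[OF assms]] by (auto simp: future_def)

end

section \<open>The order of the canonical tree\<close>

text \<open>An entry \<open>(\<Delta>, n)\<close> of a moment leaves the current moment with label \<open>\<Delta>\<close> and goes to position \<open>n\<close> of the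
  trunk that starts there; position \<open>n + 1\<close> precedes position \<open>n\<close>.\<close>

fun path_le :: "('a \<times> nat) list \<Rightarrow> ('a \<times> nat) list \<Rightarrow> bool" where
  "path_le [] bs \<longleftrightarrow> True"
| "path_le (a # as) [] \<longleftrightarrow> False"
| "path_le (a # as) (b # bs) \<longleftrightarrow> fst a = fst b \<and>
     (if as = [] then snd b \<le> snd a else snd b = snd a \<and> path_le as bs)"

lemma path_le_Nil [simp]: "path_le as [] \<longleftrightarrow> as = []"
  by (cases as) auto

lemma path_le_refl: "path_le as as"
  by (induction as) auto

lemma path_le_antisym: "path_le as bs \<Longrightarrow> path_le bs as \<Longrightarrow> as = bs"
  by (induction as bs rule: path_le.induct) (auto split: if_splits simp: prod_eq_iff)

lemma path_le_trans: "path_le as bs \<Longrightarrow> path_le bs cs \<Longrightarrow> path_le as cs"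
proof (induction as bs arbitrary: cs rule: path_le.induct)
  case (3 a as b bs)
  then show ?case by (cases cs) (auto split: if_splits)
qed auto

lemma path_le_linear: "path_le as cs \<Longrightarrow> path_le bs cs \<Longrightarrow> path_le as bs \<or> path_le bs as"
proof (induction as cs arbitrary: bs rule: path_le.induct)
  case (3 a as c cs)
  then show ?case by (cases bs) (auto split: if_splits)
qed auto

lemma path_le_snoc: "path_le as (as @ [b])"
  by (induction as) auto

lemma path_le_branch: "n \<le> k \<Longrightarrow> path_le (as @ [(D, k)]) (as @ [(D, n)])"
  by (induction as) auto

section \<open>Sets attached to paths\<close>

context jstit_logic
begin

text \<open>The label with which a path to the second argument leaves the first: that of the next
  entry, or, when the path moves up the current trunk, the future of its label. The last equation is
  a default value.\<close>

fun dir :: "'ag moment \<Rightarrow> 'ag moment \<Rightarrow> 'ag form set" where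
  "dir [] (b # bs) = fst b"
| "dir (a # as) (b # bs) = (if as = [] \<and> snd b < snd a then future (fst a) else dir as bs)"
| "dir as [] = {}"

text \<open>Positions are ignored: all moments of a trunk carry the same set, the future of the
  label that starts it.\<close>

fun base :: "'ag form set \<Rightarrow> 'ag moment \<Rightarrow> 'ag form set" where
  "base \<Gamma> [] = \<Gamma>"
| "base \<Gamma> (b # bs) = base (future (fst b)) bs"

fun path :: "'ag form set \<Rightarrow> 'ag moment \<Rightarrow> bool" where
  "path \<Gamma> [] \<longleftrightarrow> True"
| "path \<Gamma> (b # bs) \<longleftrightarrow> mcs (fst b) \<and> Box_eq \<Gamma> (fst b) \<and> path (future (fst b)) bs"

lemma base_append: "base \<Gamma> (as @ bs) = base (base \<Gamma> as) bs"
  by (induction as arbitrary: \<Gamma>) auto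

lemma path_append: "path \<Gamma> (as @ bs) \<longleftrightarrow> path \<Gamma> as \<and> path (base \<Gamma> as) bs"
  by (induction as arbitrary: \<Gamma>) auto

lemma base_mcs: "mcs \<Gamma> \<Longrightarrow> path \<Gamma> bs \<Longrightarrow> mcs (base \<Gamma> bs)"
  by (induction bs arbitrary: \<Gamma>) (auto simp: future)

text \<open>Knowledge passes to a label within one \<open>Box\<close>-class, and from a label to its
  future by \<open>follows\<close>.\<close>

lemma base_Know: "mcs \<Gamma> \<Longrightarrow> path \<Gamma> bs \<Longrightarrow> Know A \<in> \<Gamma> \<Longrightarrow> Know A \<in> base \<Gamma> bs"
proof (induction bs arbitrary: \<Gamma>)
  case (Cons b bs)
  then have b: "mcs (fst b)" "Box_eq \<Gamma> (fst b)" by auto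
  then have "Know A \<in> future (fst b)"
    using Box_eq_Know[OF Cons.prems(1) b] Cons.prems(3) future(2)[OF b(1)] by (simp add: follows_def)
  then show ?case using Cons future(1)[OF b(1)] by simp
qed simp

lemma base_Box_Presented:
  "mcs \<Gamma> \<Longrightarrow> path \<Gamma> bs \<Longrightarrow> Box (Presented t) \<in> \<Gamma> \<Longrightarrow> Box (Presented t) \<in> base \<Gamma> bs"
  using base_Know[OF _ _ mcs_Know_Box_Presented] mcs_KnowD[OF base_mcs] by blast

lemma follows_base: "follows \<Delta> \<Gamma> \<Longrightarrow> mcs \<Gamma> \<Longrightarrow> path \<Gamma> bs \<Longrightarrow> follows \<Delta> (base \<Gamma> bs)"
  by (simp add: follows_def base_Know base_Box_Presented)

text \<open>A move up a trunk has a label that is its own future; any other move starts a trunk with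
  the future of its label. Persistence along the remaining path carries \<open>follows\<close> to
  its end.\<close>

lemma dir_spec:
  "mcs \<Gamma> \<Longrightarrow> path \<Gamma> bs \<Longrightarrow> path_le as bs \<Longrightarrow> as \<noteq> bs \<Longrightarrow>
    mcs (dir as bs) \<and> Box_eq (base \<Gamma> as) (dir as bs) \<and> follows (dir as bs) (base \<Gamma> bs)"
proof (induction as bs arbitrary: \<Gamma> rule: dir.induct)
  case (1 b bs)
  then show ?case using future[of "fst b"] follows_base by auto
next
  case (2 a as b bs)
  then have b: "mcs (fst b)" "fst a = fst b" "path (future (fst b)) bs" by auto
  show ?case
  proof (cases "as = [] \<and> snd b < snd a")
    case True
    then show ?thesis using b future[of "fst b"] follows_base by auto
  next
    case False
    then have "path_le as bs" "as \<noteq> bs"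
      using "2.prems"(3,4) by (auto simp: prod_eq_iff split: if_splits)
    with "2.IH"[OF False future(1)[OF b(1)] b(3)] show ?thesis
      using False b(2) by auto
  qed
qed auto

text \<open>Only the first move above \<open>as\<close> matters, and passing through
  \<open>bs\<close> fixes it. Departure labels can therefore be attached to histories.\<close>

lemma dir_mono: "path_le as bs \<Longrightarrow> as \<noteq> bs \<Longrightarrow> path_le bs cs \<Longrightarrow> dir as cs = dir as bs"
proof (induction as bs arbitrary: cs rule: dir.induct)
  case (1 b bs)
  then show ?case by (cases cs) auto
next
  case (2 a as b bs)
  then show ?case by (cases cs) (auto split: if_splits simp: prod_eq_iff)
qed auto

lemma dir_snoc: "dir as (as @ [b]) = fst b"
  by (induction as) auto

lemma dir_trunk: "n < k \<Longrightarrow> dir (as @ [(\<Delta>, k)]) (as @ [(\<Delta>, n)]) = future \<Delta>"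
  by (induction as) auto

text \<open>The moments directly above the root carry an arbitrary maximal consistent set, which need not be
  its own future; therefore only position \<open>0\<close> is admitted there.\<close>

definition moments :: "'ag moment set" where
  "moments = insert [] {(\<Gamma>, 0) # as | \<Gamma> as. mcs \<Gamma> \<and> path \<Gamma> as}"

definition rep :: "'ag moment \<Rightarrow> 'ag form set" where
  "rep m = base (fst (hd m)) (tl m)"

lemma rep_mcs: "m \<in> moments \<Longrightarrow> m \<noteq> [] \<Longrightarrow> mcs (rep m)"
  by (auto simp: moments_def rep_def base_mcs)

lemma snoc_in_moments:
  "m \<in> moments \<Longrightarrow> mcs \<Delta> \<Longrightarrow> m \<noteq> [] \<longrightarrow> Box_eq (rep m) \<Delta> \<Longrightarrow> m @ [(\<Delta>, 0)] \<in> moments"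
  by (auto simp: moments_def rep_def path_append)

lemma moments_dir:
  assumes "m \<in> moments" "m' \<in> moments" "path_le m m'" "m \<noteq> m'"
  shows "mcs (dir m m')" "m \<noteq> [] \<Longrightarrow> Box_eq (rep m) (dir m m')"
    "m \<noteq> [] \<Longrightarrow> follows (dir m m') (rep m')"
proof -
  obtain \<Gamma> bs where m': "m' = (\<Gamma>, 0) # bs" "mcs \<Gamma>" "path \<Gamma> bs"
    using assms by (auto simp: moments_def)
  have "mcs (dir m m') \<and> (m \<noteq> [] \<longrightarrow> Box_eq (rep m) (dir m m') \<and> follows (dir m m') (rep m'))"
  proof (cases m)
    case Nil
    then show ?thesis using m' by simp
  next
    case (Cons a as)
    then have "a = (\<Gamma>, 0)" "path_le as bs" "as \<noteq> bs"
      using assms m' by (auto simp: moments_def split: if_splits)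
    then show ?thesis using dir_spec[OF m'(2,3)] Cons m'(1) by (simp add: rep_def)
  qed
  then show "mcs (dir m m')" "m \<noteq> [] \<Longrightarrow> Box_eq (rep m) (dir m m')"
    "m \<noteq> [] \<Longrightarrow> follows (dir m m') (rep m')" by auto
qed

lemma moments_dir_root:
  assumes "m \<in> moments" "m \<noteq> []"
  shows "Box (Presented t) \<in> dir [] m \<Longrightarrow> Box (Presented t) \<in> rep m"
  using assms by (auto simp: moments_def rep_def base_Box_Presented)

text \<open>Since a trunk is a copy of the natural numbers in reverse order, a necessarily presented proof
  has always been presented before, as condition (8) demands.\<close>

lemma presented_before:
  assumes "m \<in> moments" "m \<noteq> []"
  obtains m' where "m' \<in> moments" "path_le m' m" "m' \<noteq> m"
    "\<And>t. Box (Presented t) \<in> rep m \<Longrightarrow>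
      (if m' = [] then Box (Presented t) else Presented t) \<in> dir m' m"
proof -
  obtain \<Gamma> as where m: "m = (\<Gamma>, 0) # as" "mcs \<Gamma>" "path \<Gamma> as"
    using assms by (auto simp: moments_def)
  show thesis
  proof (cases as rule: rev_cases)
    case Nil
    \<comment> \<open>Directly above the root the earlier moment is the root, which is left with the
      label \<open>rep m\<close> itself.\<close>
    then show thesis using that[of "[]"] m by (auto simp: moments_def rep_def)
  next
    case (snoc bs b)
    obtain \<Delta> n where b: "b = (\<Delta>, n)" by force
    \<comment> \<open>One position earlier on the same trunk; this moment is left with the label
      \<open>future \<Delta>\<close>, which is also \<open>rep m\<close>.\<close>
    let ?m = "((\<Gamma>, 0) # bs) @ [(\<Delta>, Suc n)]"
    have eq: "m = ((\<Gamma>, 0) # bs) @ [(\<Delta>, n)]" using m snoc b by simp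
    have "dir ?m m = rep m"
      unfolding eq dir_trunk[OF lessI] by (simp add: rep_def base_append)
    moreover have "?m \<in> moments" using m snoc b by (auto simp: moments_def path_append)
    moreover have "path_le ?m m" unfolding eq by (rule path_le_branch) simp
    ultimately show thesis
      using that[of ?m] mcs_BoxD[OF rep_mcs[OF assms]] eq by auto
  qed
qed

section \<open>The canonical model\<close>

text \<open>Apart from the order the components are placeholders: histories must be available before
  choices, actions and the valuation can be defined from their labels.\<close>

definition frame :: "('ag, 'ag moment) jstit" where
  "frame = \<lparr>Tree = moments, le = {(m, m'). m \<in> moments \<and> m' \<in> moments \<and> path_le m m'},
     Choice = \<lambda>m j. {}, Act = \<lambda>m h. {}, R = {}, Re = {}, Evid = \<lambda>m t. {}, Val = \<lambda>p. {}\<rparr>"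

abbreviation H :: "'ag moment \<Rightarrow> 'ag moment set set" where
  "H \<equiv> hist_thru frame"

definition label :: "'ag moment \<Rightarrow> 'ag moment set \<Rightarrow> 'ag form set" where
  "label m h = dir m (SOME m'. m' \<in> h \<and> path_le m m' \<and> m \<noteq> m')"

text \<open>The root has a single cell: labels there are arbitrary maximal consistent sets, not
  members of one \<open>Box\<close>-class, so \<open>A3\<close> gives no common history.\<close>

definition choice_cell :: "'ag moment \<Rightarrow> 'ag \<Rightarrow> 'ag moment set \<Rightarrow> 'ag moment set set" where
  "choice_cell m j h = {h' \<in> H m. m = [] \<or> Stit_eq j (label m h) (label m h')}"

definition epistemic :: "('ag moment \<times> 'ag moment) set" where
  "epistemic = {(m, m'). m \<in> moments \<and> m' \<in> moments \<and>
     (m = [] \<or> m' \<noteq> [] \<and> (\<forall>A. Know A \<in> rep m \<longrightarrow> Know A \<in> rep m'))}"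

text \<open>The truth lemma fails at the root (\<open>rep []\<close> is junk), but no other moment sees it. Its \<open>Act\<close> is
  chosen such that (8) holds directly above it; (8) at the root itself requires a maximal consistent
  set without presented proofs.\<close>

definition canonical :: "('ag, 'ag moment) jstit" where
  "canonical = \<lparr>Tree = moments, le = le frame,
     Choice = \<lambda>m j. choice_cell m j ` H m,
     Act = \<lambda>m h. {t. (if m = [] then Box (Presented t) else Presented t) \<in> label m h},
     R = epistemic, Re = epistemic,
     Evid = \<lambda>m t. {A. if m = [] then \<turnstile> (t \<^bold>: A) else t \<^bold>: A \<in> rep m},
     Val = \<lambda>p. {(m, h). m \<in> moments \<and> h \<in> H m \<and> Var p \<in> label m h}\<rparr>"

section \<open>Histories of the canonical tree and their labels\<close>

lemma le_frame: "(m, m') \<in> le frame \<longleftrightarrow> m \<in> moments \<and> m' \<in> moments \<and> path_le m m'"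
  by (simp add: frame_def)

lemma Tree_frame: "Tree frame = moments"
  by (simp add: frame_def)

interpretation tree: jstit_tree frame
proof
  show "partial_order_on (Tree frame) (le frame)"
    unfolding partial_order_on_def preorder_on_def refl_on_def trans_def antisym_def Tree_frame
    using path_le_refl path_le_trans path_le_antisym by (auto simp: le_frame)
  show "(m1, m) \<in> le frame \<Longrightarrow> (m2, m) \<in> le frame \<Longrightarrow> (m1, m2) \<in> le frame \<or> (m2, m1) \<in> le frame"
    for m1 m m2 using path_le_linear by (auto simp: le_frame)
qed

lemma H_moments: "h \<in> H m \<Longrightarrow> m' \<in> h \<Longrightarrow> m' \<in> moments"
  using tree.history_comparable[of h m' m'] by (auto simp: hist_thru_def le_frame)

text \<open>Two later moments of one history are comparable, so \<open>dir_mono\<close> makes their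
  departure labels agree.\<close>

lemma label_eq:
  assumes h: "h \<in> H m" and m': "m' \<in> h" "path_le m m'" "m \<noteq> m'"
  shows "label m h = dir m m'"
proof -
  define x where "x = (SOME m'. m' \<in> h \<and> path_le m m' \<and> m \<noteq> m')"
  have x: "x \<in> h \<and> path_le m x \<and> m \<noteq> x"
    unfolding x_def by (rule someI[of _ m']) (use m' in blast)
  then have "path_le m' x \<or> path_le x m'"
    using tree.history_comparable[of h m' x] h m'(1) by (auto simp: hist_thru_def le_frame)
  then show ?thesis
    unfolding label_def x_def[symmetric] using x m' dir_mono[of m m' x] dir_mono[of m x m'] by auto
qed

lemma label_past:
  assumes "h \<in> H m" "(m', m) \<in> lt frame"
  shows "label m' h = dir m' m"
proof (rule label_eq)
  show "h \<in> H m'" using assms tree.hist_thru_antimono[of m' m] by (auto simp: lt_def)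
qed (use assms in \<open>auto simp: hist_thru_def lt_def le_frame\<close>)

text \<open>A shared later moment determines both labels. Both conditions on undivided histories,
  for cells and for presented proofs, come from this.\<close>

lemma label_undivided: "undivided frame m h h' \<Longrightarrow> label m h = label m h'"
  using label_eq by (auto simp: undivided_def lt_def le_frame)

lemma history_with_label:
  assumes m: "m \<in> moments" and \<Delta>: "mcs \<Delta>" "m \<noteq> [] \<longrightarrow> Box_eq (rep m) \<Delta>"
  obtains h where "h \<in> H m" "label m h = \<Delta>"
proof -
  let ?m = "m @ [(\<Delta>, 0)]"
  have "?m \<in> Tree frame" using snoc_in_moments[OF m \<Delta>] by (simp add: Tree_frame)
  then obtain h where h: "h \<in> H ?m" by (rule tree.hist_thru_nonempty)
  have mm: "(m, ?m) \<in> lt frame"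
    using m snoc_in_moments[OF m \<Delta>] path_le_snoc by (simp add: lt_def le_frame)
  then have "label m h = \<Delta>" using label_past[OF h mm] by (simp add: dir_snoc)
  moreover have "h \<in> H m" using h tree.hist_thru_antimono[of m ?m] mm by (auto simp: lt_def)
  ultimately show thesis using that by blast
qed

text \<open>No history ends: if \<open>m\<close> were last, an appended branch would lie above the
  whole history, against maximality. So a later moment exists and \<open>moments_dir\<close>
  applies.\<close>

lemma label_spec:
  assumes m: "m \<in> moments" and h: "h \<in> H m" and ex: "mcs \<Gamma>"
  shows "mcs (label m h)" "m \<noteq> [] \<Longrightarrow> Box_eq (rep m) (label m h)"
proof -
  \<comment> \<open>Any admissible label will do; \<open>\<Gamma>\<close> serves at the root, where
    \<open>rep\<close> supplies none.\<close>
  define \<Delta> where "\<Delta> = (if m = [] then \<Gamma> else rep m)"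
  have \<Delta>: "mcs \<Delta>" "m \<noteq> [] \<longrightarrow> Box_eq (rep m) \<Delta>"
    using ex rep_mcs[OF m] by (auto simp: \<Delta>_def)
  have hh: "h \<in> histories frame" "m \<in> h" using h by (auto simp: hist_thru_def)
  have "\<exists>m'\<in>h. path_le m m' \<and> m \<noteq> m'"
  proof (rule ccontr)
    assume none: "\<not> ?thesis"
    have "m @ [(\<Delta>, 0)] \<in> h"
    proof (rule tree.history_maximal[OF hh(1)])
      show "m @ [(\<Delta>, 0)] \<in> Tree frame"
        using snoc_in_moments[OF m \<Delta>] by (simp add: Tree_frame)
      fix x assume x: "x \<in> h"
      then have "path_le x m"
        using tree.history_comparable[OF hh(1) x hh(2)] none by (auto simp: le_frame)
      then show "(x, m @ [(\<Delta>, 0)]) \<in> le frame \<or> (m @ [(\<Delta>, 0)], x) \<in> le frame"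
        using path_le_trans[OF _ path_le_snoc] snoc_in_moments[OF m \<Delta>] H_moments[OF h x]
        by (auto simp: le_frame)
    qed
    then show False using none path_le_snoc by force
  qed
  then obtain m' where m': "m' \<in> h" "path_le m m'" "m \<noteq> m'" by blast
  then show "mcs (label m h)" "m \<noteq> [] \<Longrightarrow> Box_eq (rep m) (label m h)"
    using moments_dir[OF m H_moments[OF h m'(1)] m'(2,3)] label_eq[OF h m'] by auto
qed

section \<open>Conditions on the canonical model\<close>

lemma canonical_simps [simp]:
  "Tree canonical = moments" "le canonical = le frame" "lt canonical = lt frame"
  "R canonical = epistemic" "Re canonical = epistemic"
  "Choice canonical m j = choice_cell m j ` H m"
  "Act canonical m h = {t. (if m = [] then Box (Presented t) else Presented t) \<in> label m h}"
  "Evid canonical m t = {A. if m = [] then \<turnstile> (t \<^bold>: A) else t \<^bold>: A \<in> rep m}"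
  "Val canonical p = {(m, h). m \<in> moments \<and> h \<in> H m \<and> Var p \<in> label m h}"
  by (simp_all add: canonical_def lt_def)

lemma hist_thru_canonical [simp]: "hist_thru canonical = H"
  by (simp add: fun_eq_iff hist_thru_def histories_def)

lemma undivided_canonical [simp]: "undivided canonical = undivided frame"
  by (simp add: fun_eq_iff undivided_def)

lemma choice_cell_refl: "h \<in> H m \<Longrightarrow> h \<in> choice_cell m j h"
  by (simp add: choice_cell_def Stit_eq_def)

lemma choice_cell_eq: "h' \<in> choice_cell m j h \<Longrightarrow> choice_cell m j h' = choice_cell m j h"
  by (auto simp: choice_cell_def Stit_eq_def)

lemma cell_canonical:
  assumes "h \<in> H m"
  shows "cell canonical m j h = choice_cell m j h"
  unfolding cell_def
  by (rule the_equality) (use assms choice_cell_refl choice_cell_eq in auto)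

lemma choice_cells_partition: "partition_on (H m) (choice_cell m j ` H m)"
proof (rule partition_onI)
  show "\<Union> (choice_cell m j ` H m) = H m"
    using choice_cell_refl by (auto simp: choice_cell_def)
  show "disjnt p p'" if pp: "p \<in> choice_cell m j ` H m" "p' \<in> choice_cell m j ` H m" "p \<noteq> p'" for p p'
  proof -
    obtain h where h: "p = choice_cell m j h" using pp(1) by (rule imageE)
    obtain h' where h': "p' = choice_cell m j h'" using pp(2) by (rule imageE)
    show ?thesis
      unfolding disjnt_iff
    proof (intro allI notI)
      fix x assume "x \<in> p \<and> x \<in> p'"
      then have "choice_cell m j x = p" "choice_cell m j x = p'"
        unfolding h h' by (simp_all only: choice_cell_eq)
      then show False using pp(3) by simp
    qed
  qed
  show "{} \<notin> choice_cell m j ` H m"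
  proof
    assume "{} \<in> choice_cell m j ` H m"
    then obtain h where "h \<in> H m" "{} = choice_cell m j h" by (rule imageE)
    then show False using choice_cell_refl[of h m j] by simp
  qed
qed

lemma epistemic_preorder: "preorder_on moments epistemic"
  unfolding preorder_on_def refl_on_def trans_def by (auto simp: epistemic_def)

lemma le_sub_epistemic: "le frame \<subseteq> epistemic"
proof (rule subrelI)
  fix m m' assume "(m, m') \<in> le frame"
  then have m: "m \<in> moments" "m' \<in> moments" "path_le m m'" by (auto simp: le_frame)
  have "Know A \<in> rep m'" if "m \<noteq> []" "Know A \<in> rep m" "m \<noteq> m'" for A
    using moments_dir[OF m that(3)] that(1,2) Box_eq_Know[OF rep_mcs[OF m(1)]]
    by (auto simp: follows_def)
  then show "(m, m') \<in> epistemic" using m by (cases "m = m'") (auto simp: epistemic_def)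
qed

text \<open>Away from the root, \<open>mcs_independence\<close> merges the labels of the chosen
  histories into one set of the same \<open>Box\<close>-class, and this set is the label of a
  history.\<close>

lemma canonical_independence:
  assumes m: "m \<in> moments" and f: "\<And>j. f j \<in> choice_cell m j ` H m"
  shows "(\<Inter>j. f j) \<noteq> {}"
proof -
  have "\<forall>j. \<exists>h. h \<in> H m \<and> f j = choice_cell m j h" using f by blast
  from choice[OF this] obtain g where g: "\<forall>j. g j \<in> H m \<and> f j = choice_cell m j (g j)" ..
  have "\<exists>h\<in>H m. \<forall>j. h \<in> choice_cell m j (g j)"
  proof (cases "m = []")
    case True
    then show ?thesis using g by (auto simp: choice_cell_def)
  next
    case False
    note l = label_spec[OF m _ rep_mcs[OF m False]]
    obtain \<Theta> where \<Theta>: "mcs \<Theta>" "\<And>j. Stit_eq j (label m (g j)) \<Theta>"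
      by (rule mcs_independence[OF rep_mcs[OF m False], of "\<lambda>j. label m (g j)"])
        (use l g False in auto)
    have "Box_eq (rep m) \<Theta>"
      using Box_eq_trans[OF l(2) Stit_eq_imp_Box_eq[OF l(1) \<Theta>]] g False by blast
    then obtain h where "h \<in> H m" "label m h = \<Theta>"
      using history_with_label[OF m \<Theta>(1)] by blast
    then show ?thesis using \<Theta>(2) by (auto simp: choice_cell_def)
  qed
  then show ?thesis using g by auto
qed

lemma rep_Evid_closed:
  assumes \<Delta>: "mcs \<Delta>"
  shows "s \<^bold>: (A \<^bold>\<longrightarrow> B) \<in> \<Delta> \<Longrightarrow> t \<^bold>: A \<in> \<Delta> \<Longrightarrow> PTimes s t \<^bold>: B \<in> \<Delta>"
    "s \<^bold>: A \<in> \<Delta> \<or> t \<^bold>: A \<in> \<Delta> \<Longrightarrow> PSum s t \<^bold>: A \<in> \<Delta>"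
    "t \<^bold>: A \<in> \<Delta> \<Longrightarrow> PBang t \<^bold>: (t \<^bold>: A) \<in> \<Delta>"
  using mcs_ax[OF \<Delta> ax.A4[of s A B t]] mcs_ax[OF \<Delta> ax.A6[of s A t]] mcs_ax[OF \<Delta> ax.A5[of t A]] \<Delta>
  by auto

text \<open>One description for the root and all other moments, which reduces the closure conditions
  on evidence to \<open>rep_Evid_closed\<close>.\<close>

lemma canonical_Evid_alt:
  "m \<in> moments \<Longrightarrow> A \<in> Evid canonical m t \<longleftrightarrow>
    (\<forall>\<Delta>. mcs \<Delta> \<and> (m \<noteq> [] \<longrightarrow> \<Delta> = rep m) \<longrightarrow> t \<^bold>: A \<in> \<Delta>)"
  by (auto simp: derivable_iff_all_mcs rep_mcs)

text \<open>If the boxed formula is missing, \<open>mcs_successor\<close> gives a label of the same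
  class without \<open>Presented t\<close>. Conditions on \<open>Act\<close> thereby become
  statements about \<open>rep\<close>.\<close>

lemma canonical_necessary_Act:
  assumes m: "m \<in> moments" "m \<noteq> []"
  shows "(\<Inter>h\<in>H m. Act canonical m h) = {t. Box (Presented t) \<in> rep m}"
proof (intro set_eqI iffI)
  fix t assume t: "t \<in> (\<Inter>h\<in>H m. Act canonical m h)"
  show "t \<in> {t. Box (Presented t) \<in> rep m}"
  proof (rule ccontr)
    assume "t \<notin> {t. Box (Presented t) \<in> rep m}"
    then obtain \<Delta> where \<Delta>: "mcs \<Delta>" "\<And>B. Box B \<in> rep m \<Longrightarrow> B \<in> \<Delta>" "Presented t \<notin> \<Delta>"
      using mcs_successor[OF rep_mcs[OF m] normal_Box, of "Presented t"] by blast
    then obtain h where "h \<in> H m" "label m h = \<Delta>"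
      using history_with_label[OF m(1) \<Delta>(1)] Box_eqI[OF rep_mcs[OF m]] by blast
    then show False using t \<Delta>(3) m(2) by auto
  qed
next
  fix t assume t: "t \<in> {t. Box (Presented t) \<in> rep m}"
  have "Presented t \<in> label m h" if "h \<in> H m" for h
  proof -
    note l = label_spec[OF m(1) that rep_mcs[OF m]]
    have "Box (Presented t) \<in> label m h" using l(2)[OF m(2)] t by (simp add: Box_eq_def)
    then show ?thesis by (rule mcs_BoxD[OF l(1)])
  qed
  then show "t \<in> (\<Inter>h\<in>H m. Act canonical m h)" using m(2) by auto
qed

text \<open>What is presented earlier becomes necessary at \<open>m\<close>: a label is followed by
  \<open>rep m\<close>, and at the root \<open>Act\<close> already asks for the boxed formula, which
  persists by \<open>A9\<close>.\<close>

lemma canonical_Act_mono: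
  assumes lt: "(m', m) \<in> lt frame" and h: "h \<in> H m"
  shows "Act canonical m' h \<subseteq> Act canonical m h"
proof
  fix t assume t: "t \<in> Act canonical m' h"
  have m: "m' \<in> moments" "m \<in> moments" "path_le m' m" "m' \<noteq> m"
    using lt by (auto simp: lt_def le_frame)
  then have ne: "m \<noteq> []" by auto
  have "Box (Presented t) \<in> rep m"
    using t moments_dir_root[OF m(2) ne] moments_dir(3)[OF m] label_past[OF h lt]
    by (auto simp: follows_def split: if_splits)
  then show "t \<in> Act canonical m h" using canonical_necessary_Act[OF m(2) ne] h by blast
qed

text \<open>At the root, a history labelled \<open>\<Gamma>\<close> empties the intersection.
  Elsewhere \<open>presented_before\<close> supplies the earlier moment.\<close>

lemma canonical_Act_past:
  assumes silent: "mcs \<Gamma>" "\<And>t. Presented t \<notin> \<Gamma>" and m: "m \<in> moments"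
  shows "(\<Inter>h\<in>H m. Act canonical m h)
    \<subseteq> (\<Union>m'\<in>{m'. (m', m) \<in> lt frame}. \<Union>h\<in>H m. Act canonical m' h)"
proof (cases "m = []")
  case True
  obtain h where "h \<in> H m" "label m h = \<Gamma>"
    using history_with_label[OF m silent(1)] True by blast
  then have "(\<Inter>h\<in>H m. Act canonical m h) = {}"
    using True silent mcs_BoxD[OF silent(1)] by auto
  then show ?thesis by simp
next
  case False
  obtain m' where m': "m' \<in> moments" "path_le m' m" "m' \<noteq> m"
    "\<And>t. Box (Presented t) \<in> rep m \<Longrightarrow>
      (if m' = [] then Box (Presented t) else Presented t) \<in> dir m' m"
    using presented_before[OF m False] by blast
  then have lt: "(m', m) \<in> lt frame" using m by (simp add: lt_def le_frame)
  have "m \<in> Tree frame" using m by (simp add: Tree_frame)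
  then obtain h where h: "h \<in> H m" by (rule tree.hist_thru_nonempty)
  have "(\<Inter>h\<in>H m. Act canonical m h) \<subseteq> Act canonical m' h"
    unfolding canonical_necessary_Act[OF m False] using m'(4) label_past[OF h lt] by auto
  then show ?thesis using lt h by blast
qed

text \<open>At the root the intersection is empty by \<open>canonical_Act_past\<close>, as nothing
  precedes it. Elsewhere \<open>A9\<close> makes necessary presentation known, and
  \<open>epistemic\<close> transports knowledge.\<close>

lemma canonical_Act_epistemic:
  assumes silent: "mcs \<Gamma>" "\<And>t. Presented t \<notin> \<Gamma>" and e: "(m, m') \<in> epistemic"
  shows "(\<Inter>h\<in>H m. Act canonical m h) \<subseteq> (\<Inter>h\<in>H m'. Act canonical m' h)"
proof (cases "m = []")
  case True
  have m: "m \<in> moments" using e by (simp add: epistemic_def)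
  have "{m'. (m', m) \<in> lt frame} = {}" using True by (auto simp: lt_def le_frame)
  then have "(\<Inter>h\<in>H m. Act canonical m h) = {}" using canonical_Act_past[OF silent m] by auto
  then show ?thesis by simp
next
  case False
  then have m: "m \<in> moments" "m' \<in> moments" "m' \<noteq> []" "\<forall>A. Know A \<in> rep m \<longrightarrow> Know A \<in> rep m'"
    using e by (auto simp: epistemic_def)
  show ?thesis
    unfolding canonical_necessary_Act[OF m(1) False] canonical_necessary_Act[OF m(2,3)]
    using mcs_Know_Box_Presented[OF rep_mcs[OF m(1) False]] mcs_KnowD[OF rep_mcs[OF m(2,3)]] m(4)
    by blast
qed

lemma canonical_Evid_mono:
  assumes "(m, m') \<in> epistemic"
  shows "Evid canonical m t \<subseteq> Evid canonical m' t"
proof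
  fix A assume A: "A \<in> Evid canonical m t"
  show "A \<in> Evid canonical m' t"
  proof (cases "m = []")
    case True
    then show ?thesis using A assms mcs_derivable rep_mcs by (auto simp: epistemic_def)
  next
    case False
    then show ?thesis
      using A assms mcs_Know_Just[of "rep m"] mcs_KnowD[of "rep m'"] rep_mcs
      by (auto simp: epistemic_def)
  qed
qed

lemma canonical_model:
  assumes silent: "mcs \<Gamma>" "\<And>t. Presented t \<notin> \<Gamma>"
  shows "is_jstit_model canonical"
proof -
  have "\<forall>m1\<in>Tree canonical. \<forall>m2\<in>Tree canonical. \<exists>m\<in>Tree canonical.
      (m, m1) \<in> le canonical \<and> (m, m2) \<in> le canonical"
    by (auto simp: le_frame moments_def intro: bexI[of _ "[]"])
  moreover have "\<forall>m\<in>Tree canonical. \<forall>h h' j. undivided canonical m h h' \<longrightarrow>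
      cell canonical m j h = cell canonical m j h'"
  proof (intro ballI allI impI)
    fix m h h' j assume u: "undivided canonical m h h'"
    then have "h \<in> H m" "h' \<in> H m" by (auto simp: undivided_def)
    then show "cell canonical m j h = cell canonical m j h'"
      using label_undivided u by (simp add: cell_canonical choice_cell_def)
  qed
  moreover have "\<forall>m\<in>Tree canonical. \<forall>s t A B.
      ((A \<^bold>\<longrightarrow> B) \<in> Evid canonical m s \<and> A \<in> Evid canonical m t \<longrightarrow>
        B \<in> Evid canonical m (PTimes s t)) \<and>
      Evid canonical m s \<union> Evid canonical m t \<subseteq> Evid canonical m (PSum s t) \<and>
      (A \<in> Evid canonical m t \<longrightarrow> (t \<^bold>: A) \<in> Evid canonical m (PBang t))"
  proof (intro ballI allI)
    fix m s t A B assume "m \<in> Tree canonical"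
    then have alt: "C \<in> Evid canonical m u \<longleftrightarrow>
        (\<forall>\<Delta>. mcs \<Delta> \<and> (m \<noteq> [] \<longrightarrow> \<Delta> = rep m) \<longrightarrow> u \<^bold>: C \<in> \<Delta>)" for C u
      using canonical_Evid_alt by simp
    have "(A \<^bold>\<longrightarrow> B) \<in> Evid canonical m s \<and> A \<in> Evid canonical m t \<longrightarrow>
        B \<in> Evid canonical m (PTimes s t)"
      unfolding alt using rep_Evid_closed(1) by blast
    moreover have "Evid canonical m s \<union> Evid canonical m t \<subseteq> Evid canonical m (PSum s t)"
      unfolding subset_iff Un_iff alt using rep_Evid_closed(2) by blast
    moreover have "A \<in> Evid canonical m t \<longrightarrow> (t \<^bold>: A) \<in> Evid canonical m (PBang t)"
      unfolding alt using rep_Evid_closed(3) by blast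
    ultimately show "((A \<^bold>\<longrightarrow> B) \<in> Evid canonical m s \<and> A \<in> Evid canonical m t \<longrightarrow>
        B \<in> Evid canonical m (PTimes s t)) \<and>
      Evid canonical m s \<union> Evid canonical m t \<subseteq> Evid canonical m (PSum s t) \<and>
      (A \<in> Evid canonical m t \<longrightarrow> (t \<^bold>: A) \<in> Evid canonical m (PBang t))" by blast
  qed
  moreover have "\<forall>m\<in>Tree canonical. \<forall>h h'. undivided canonical m h h' \<longrightarrow>
      Act canonical m h = Act canonical m h'"
    using label_undivided by auto
  moreover have "\<forall>m\<in>Tree canonical. \<forall>f. (\<forall>j. f j \<in> Choice canonical m j) \<longrightarrow> (\<Inter>j. f j) \<noteq> {}"
    using canonical_independence by (simp only: canonical_simps) blast
  moreover have "\<forall>p. Val canonical p \<subseteq> MH canonical"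
    by (auto simp: MH_def)
  moreover have "\<forall>m m' h. (m', m) \<in> lt canonical \<and> h \<in> hist_thru canonical m \<longrightarrow>
      Act canonical m' h \<subseteq> Act canonical m h"
    using canonical_Act_mono by (simp only: canonical_simps(3) hist_thru_canonical) blast
  moreover have "\<forall>m\<in>Tree canonical. (\<Inter>h\<in>hist_thru canonical m. Act canonical m h)
      \<subseteq> (\<Union>m'\<in>{m'. (m', m) \<in> lt canonical}. \<Union>h\<in>hist_thru canonical m. Act canonical m' h)"
    using canonical_Act_past[OF silent] by (simp only: canonical_simps(1,3) hist_thru_canonical) blast
  moreover have "\<forall>m m'. (m, m') \<in> Re canonical \<longrightarrow>
      (\<Inter>h\<in>hist_thru canonical m. Act canonical m h) \<subseteq> (\<Inter>h'\<in>hist_thru canonical m'. Act canonical m' h')"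
    using canonical_Act_epistemic[OF silent] by (simp only: canonical_simps(5) hist_thru_canonical) blast
  moreover have "\<forall>m m' t. (m, m') \<in> Re canonical \<longrightarrow> Evid canonical m t \<subseteq> Evid canonical m' t"
    using canonical_Evid_mono by (simp only: canonical_simps(5)) blast
  moreover have "Tree canonical \<noteq> {}" by (simp add: moments_def)
  moreover have "partial_order_on (Tree canonical) (le canonical)"
    using tree.le_po by (simp add: Tree_frame)
  moreover have "preorder_on (Tree canonical) (R canonical)" "preorder_on (Tree canonical) (Re canonical)"
    using epistemic_preorder by simp_all
  moreover have "R canonical \<subseteq> Re canonical" by simp
  moreover have "\<forall>m\<in>Tree canonical. \<forall>j. partition_on (hist_thru canonical m) (Choice canonical m j)"
    using choice_cells_partition by simp
  moreover have "\<forall>m1 m2 m. (m1, m) \<in> le canonical \<and> (m2, m) \<in> le canonical \<longrightarrow>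
      (m1, m2) \<in> le canonical \<or> (m2, m1) \<in> le canonical"
    using tree.no_backward_branching by (simp only: canonical_simps(2)) blast
  moreover have "le canonical \<subseteq> R canonical" using le_sub_epistemic by simp
  ultimately show ?thesis unfolding is_jstit_model_def by (intro conjI)
qed

lemma canonical_normal: "normal_for CS canonical"
  unfolding normal_for_def
proof (intro allI ballI subsetI)
  fix c m A assume m: "m \<in> Tree canonical" and A: "A \<in> {A. PConst c \<^bold>: A \<in> CS}"
  from A have "\<turnstile> (PConst c \<^bold>: A)" by (simp add: derivable.R_CS)
  then show "A \<in> Evid canonical m (PConst c)" using m mcs_derivable rep_mcs by auto
qed

section \<open>The truth lemma\<close>

lemma Know_label:
  assumes m: "m \<in> moments" "m \<noteq> []" and h: "h \<in> H m"
  shows "Know A \<in> label m h \<longleftrightarrow> Know A \<in> rep m"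
    and "t \<^bold>: A \<in> label m h \<longleftrightarrow> t \<^bold>: A \<in> rep m"
proof -
  note l = label_spec[OF m(1) h rep_mcs[OF m]]
  show "Know A \<in> label m h \<longleftrightarrow> Know A \<in> rep m"
    using Box_eq_Know[OF rep_mcs[OF m] l(1) l(2)[OF m(2)]] by simp
  show "t \<^bold>: A \<in> label m h \<longleftrightarrow> t \<^bold>: A \<in> rep m"
    using Box_eq_Just[OF rep_mcs[OF m] l(1) l(2)[OF m(2)]] by simp
qed

lemma Know_label_successor:
  assumes m: "m \<noteq> []" and A: "Know A \<in> rep m" and m': "(m, m') \<in> epistemic" "h' \<in> H m'"
  shows "m' \<in> moments \<and> m' \<noteq> [] \<and> A \<in> label m' h'"
proof -
  have mm: "m' \<in> moments" "m' \<noteq> []" and K: "Know A \<in> rep m'"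
    using m A m'(1) by (auto simp: epistemic_def)
  from K have "Know A \<in> label m' h'" by (simp only: Know_label[OF mm m'(2)])
  then have "A \<in> label m' h'" by (rule mcs_KnowD[OF label_spec(1)[OF mm(1) m'(2) rep_mcs[OF mm]]])
  with mm show ?thesis by blast
qed

lemma truth:
  "m \<in> moments \<Longrightarrow> m \<noteq> [] \<Longrightarrow> h \<in> H m \<Longrightarrow> holds canonical m h A \<longleftrightarrow> A \<in> label m h"
proof (induction A arbitrary: m h)
  case (Var p)
  then show ?case by simp
next
  case (Conj A B)
  then show ?case using label_spec(1)[OF Conj.prems(1,3) rep_mcs] by simp
next
  case (Neg A)
  then show ?case using label_spec(1)[OF Neg.prems(1,3) rep_mcs] by simp
next
  case (Stit j A)
  note l = label_spec[OF Stit.prems(1) _ rep_mcs[OF Stit.prems(1,2)]]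
  have "holds canonical m h (Stit j A) \<longleftrightarrow> (\<forall>h'\<in>choice_cell m j h. A \<in> label m h')"
    using Stit by (auto simp: cell_canonical choice_cell_def)
  also have "\<dots> \<longleftrightarrow> Stit j A \<in> label m h"
  proof
    assume A: "Stit j A \<in> label m h"
    show "\<forall>h'\<in>choice_cell m j h. A \<in> label m h'"
    proof
      fix h' assume "h' \<in> choice_cell m j h"
      then have h': "h' \<in> H m" "Stit_eq j (label m h) (label m h')"
        using Stit.prems(2) by (simp_all add: choice_cell_def)
      then have "Stit j A \<in> label m h'" using A by (simp add: Stit_eq_def)
      then show "A \<in> label m h'" by (rule mcs_StitD[OF l(1)[OF h'(1)]])
    qed
  next
    assume all: "\<forall>h'\<in>choice_cell m j h. A \<in> label m h'"
    show "Stit j A \<in> label m h"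
    proof (rule ccontr)
      assume "Stit j A \<notin> label m h"
      then obtain \<Delta> where \<Delta>: "mcs \<Delta>" "\<And>B. Stit j B \<in> label m h \<Longrightarrow> B \<in> \<Delta>" "A \<notin> \<Delta>"
        using mcs_successor[OF l(1)[OF Stit.prems(3)] normal_Stit] by blast
      have eq: "Stit_eq j (label m h) \<Delta>"
        by (rule Stit_eqI[OF l(1)[OF Stit.prems(3)] \<Delta>(1,2)])
      \<comment> \<open>Classes of \<open>Stit_eq\<close> refine those of \<open>Box_eq\<close>, so
        \<open>\<Delta>\<close> is the label of a history through \<open>m\<close>.\<close>
      then have "Box_eq (rep m) \<Delta>"
        using Box_eq_trans[OF l(2)] Stit_eq_imp_Box_eq[OF l(1) \<Delta>(1)] Stit.prems by blast
      then obtain h' where "h' \<in> H m" "label m h' = \<Delta>"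
        using history_with_label[OF Stit.prems(1) \<Delta>(1)] by blast
      then show False using all eq \<Delta>(3) by (auto simp: choice_cell_def)
    qed
  qed
  finally show ?case .
next
  case (Box A)
  note l = label_spec[OF Box.prems(1) _ rep_mcs[OF Box.prems(1,2)]]
  have "holds canonical m h (Box A) \<longleftrightarrow> (\<forall>h'\<in>H m. A \<in> label m h')"
    using Box by simp
  also have "\<dots> \<longleftrightarrow> Box A \<in> label m h"
  proof
    assume A: "Box A \<in> label m h"
    show "\<forall>h'\<in>H m. A \<in> label m h'"
    proof
      fix h' assume h': "h' \<in> H m"
      have "Box A \<in> label m h'"
        using A l(2)[OF h'] l(2)[OF Box.prems(3)] Box.prems(2) by (simp add: Box_eq_def)
      then show "A \<in> label m h'" by (rule mcs_BoxD[OF l(1)[OF h']])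
    qed
  next
    assume all: "\<forall>h'\<in>H m. A \<in> label m h'"
    show "Box A \<in> label m h"
    proof (rule ccontr)
      assume "Box A \<notin> label m h"
      then obtain \<Delta> where \<Delta>: "mcs \<Delta>" "\<And>B. Box B \<in> label m h \<Longrightarrow> B \<in> \<Delta>" "A \<notin> \<Delta>"
        using mcs_successor[OF l(1)[OF Box.prems(3)] normal_Box] by blast
      have "Box_eq (rep m) \<Delta>"
        using Box_eq_trans[OF l(2) Box_eqI[OF l(1) \<Delta>(1,2)]] Box.prems by blast
      then obtain h' where "h' \<in> H m" "label m h' = \<Delta>"
        using history_with_label[OF Box.prems(1) \<Delta>(1)] by blast
      then show False using all \<Delta>(3) by auto
    qed
  qed
  finally show ?case .
next
  case (Just t A)
  have "holds canonical m' h' A"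
    if A: "t \<^bold>: A \<in> rep m" and m': "(m, m') \<in> epistemic" "h' \<in> H m'" for m' h'
    using Just.IH m'(2)
      Know_label_successor[OF Just.prems(2) mcs_Just_Know[OF rep_mcs[OF Just.prems(1,2)] A] m'] by blast
  then show ?case using Just.prems Know_label(2)[OF Just.prems] by auto
next
  case (Know A)
  note rm = rep_mcs[OF Know.prems(1,2)] and K = Know_label(1)[OF Know.prems]
  show ?case
  proof
    assume "Know A \<in> label m h"
    then have A: "Know A \<in> rep m" using K by simp
    have "holds canonical m' h' A" if m': "(m, m') \<in> epistemic" "h' \<in> H m'" for m' h'
      using Know.IH m'(2) Know_label_successor[OF Know.prems(2) A m'] by blast
    then show "holds canonical m h (Know A)" by simp
  next
    assume holds: "holds canonical m h (Know A)"
    show "Know A \<in> label m h"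
    proof (rule ccontr)
      assume "Know A \<notin> label m h"
      then have "Know A \<notin> rep m" using K by simp
      then obtain \<Delta> where \<Delta>: "mcs \<Delta>" "\<And>B. Know B \<in> rep m \<Longrightarrow> B \<in> \<Delta>" "A \<notin> \<Delta>"
        using mcs_successor[OF rm normal_Know] by blast
      \<comment> \<open>Every maximal consistent set is realised directly above the root, and
        \<open>epistemic\<close> does not require this moment to lie above \<open>m\<close>.\<close>
      let ?m = "[(\<Delta>, 0)]"
      have m: "?m \<in> moments" "rep ?m = \<Delta>" using \<Delta>(1) by (auto simp: moments_def rep_def)
      then have "(m, ?m) \<in> epistemic"
        using Know.prems \<Delta>(2) mcs_Know_Know[OF rm] by (auto simp: epistemic_def)
      moreover obtain h' where h': "h' \<in> H ?m" "label ?m h' = \<Delta>"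
        using history_with_label[OF m(1) \<Delta>(1)] m(2) by auto
      ultimately have "holds canonical ?m h' A" using holds by auto
      then show False using Know.IH[OF m(1) _ h'(1)] h'(2) \<Delta>(3) by simp
    qed
  qed
next
  case (Presented t)
  then show ?case by simp
qed

text \<open>The theory of the one-moment model: consistent by soundness, and maximal because it
  decides every formula.\<close>

lemma silent_mcs:
  assumes "constant_specification CS"
  obtains \<Gamma> where "mcs \<Gamma>" "\<And>t. Presented t \<notin> \<Gamma>"
proof -
  interpret silent: jstit_model silent_model
    by (rule jstit_model.intro) (rule silent_model)
  define \<Gamma> :: "'ag form set" where "\<Gamma> = {A. holds silent_model () UNIV A}"
  have "normal_for CS silent_model" by (simp add: normal_for_def silent_model_def)
  then have sound: "\<turnstile> A \<Longrightarrow> holds silent_model () UNIV A" for A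
    using silent.sound[OF assms] by (simp add: silent_histories) (simp add: silent_model_def)
  have "con \<Gamma>"
    unfolding con_def
  proof (intro allI impI notI)
    fix As assume As: "set As \<subseteq> \<Gamma>" "\<turnstile> imps As \<^bold>\<bottom>"
    from sound[OF As(2)] have "bool_eval (holds silent_model () UNIV) (imps As \<^bold>\<bottom>)"
      by (simp only: holds_bool_eval)
    then have "\<exists>A\<in>set As. \<not> holds silent_model () UNIV A"
      by (auto simp: holds_bool_eval)
    then show False using As(1) by (auto simp: \<Gamma>_def)
  qed
  moreover have "S = \<Gamma>" if S: "\<Gamma> \<subseteq> S" "con S" for S
  proof (rule ccontr)
    assume "S \<noteq> \<Gamma>"
    then obtain A where A: "A \<in> S" "A \<notin> \<Gamma>" using S(1) by blast
    then have "set [A, \<^bold>\<not> A] \<subseteq> S" using S(1) by (auto simp: \<Gamma>_def)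
    moreover have "\<turnstile> imps [A, \<^bold>\<not> A] \<^bold>\<bottom>" by (rule derivable_bool[of "[]"]) auto
    ultimately show False using S(2) unfolding con_def by blast
  qed
  ultimately have "mcs \<Gamma>" by (simp add: mcs_def)
  moreover have "Presented t \<notin> \<Gamma>" for t by (simp add: \<Gamma>_def silent_model_def)
  ultimately show thesis using that by blast
qed

lemma consistent_imp_con:
  assumes "mcs \<Gamma>" "consistent CS S"
  shows "con S"
  unfolding con_def
proof (intro allI impI notI)
  fix As assume As: "set As \<subseteq> S" "\<turnstile> imps As \<^bold>\<bottom>"
  show False
  proof (cases "As = []")
    \<comment> \<open>\<open>inconsistent\<close> excludes the empty list; here the existence of
      some maximal consistent set shows that falsum is underivable.\<close>
    case True
    then show False using mcs_imp_con[OF assms(1)] As(2) unfolding con_def by auto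
  next
    case False
    have "\<turnstile> (Conjs As \<^bold>\<longrightarrow> \<^bold>\<bottom>)"
      by (rule derivable_bool[of "[imps As \<^bold>\<bottom>]"]) (use As(2) False in \<open>auto simp: bool_eval_Conjs\<close>)
    then show False using assms(2) As(1) False unfolding inconsistent_def by blast
  qed
qed

end

text \<open>A maximal consistent extension of \<open>\<Gamma>\<close> is realised directly above the
  root, both as the set of the moment and as the label of a history through it.\<close>

lemma consistent_imp_uni_satisfiable:
  fixes CS \<Gamma> :: "'ag::finite form set"
  assumes "constant_specification CS" "consistent CS \<Gamma>"
  shows "uni_satisfiable TYPE('ag moment) CS \<Gamma>"
proof -
  interpret jstit_logic CS .
  obtain \<Gamma>\<^sub>0 where silent: "mcs \<Gamma>\<^sub>0" "\<And>t. Presented t \<notin> \<Gamma>\<^sub>0" using silent_mcs[OF assms(1)] by blast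
  obtain \<Delta> where \<Delta>: "mcs \<Delta>" "\<Gamma> \<subseteq> \<Delta>"
    using Lindenbaum[OF consistent_imp_con[OF silent(1) assms(2)]] by blast
  have m: "[(\<Delta>, 0)] \<in> moments" "rep [(\<Delta>, 0)] = \<Delta>"
    using \<Delta>(1) by (auto simp: moments_def rep_def)
  then obtain h where h: "h \<in> H [(\<Delta>, 0)]" "label [(\<Delta>, 0)] h = \<Delta>"
    using history_with_label[OF m(1) \<Delta>(1)] by auto
  have "satisfied_in canonical \<Gamma>"
    unfolding satisfied_in_def
    by (rule bexI[of _ "([(\<Delta>, 0)], h)"])
      (use m h \<Delta>(2) truth[OF m(1) _ h(1)] in \<open>auto simp: MH_def\<close>)
  moreover have "unirelational canonical" by (simp add: unirelational_def)
  ultimately show ?thesis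
    unfolding uni_satisfiable_def using canonical_model[OF silent] canonical_normal by blast
qed

lemma satisfiable_imp_consistent:
  assumes "constant_specification CS" "satisfiable TYPE('m) CS \<Gamma>"
  shows "consistent CS \<Gamma>"
  using assms satisfied_imp_consistent unfolding satisfiable_def by blast

lemma uni_satisfiable_imp_satisfiable:
  "uni_satisfiable TYPE('m) CS \<Gamma> \<Longrightarrow> satisfiable TYPE('m) CS \<Gamma>"
  unfolding uni_satisfiable_def satisfiable_def by blast

text \<open>The free type \<open>'m\<close> extends soundness to models over arbitrary types of
  moments, beyond the fixed universe that contains the canonical model.\<close>

theorem theorem3:
  fixes CS \<Gamma> :: "'ag::finite form set"
  assumes "constant_specification CS"
  shows "(consistent CS \<Gamma> \<longleftrightarrow> satisfiable TYPE('ag moment) CS \<Gamma>) \<and>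
         (consistent CS \<Gamma> \<longleftrightarrow> uni_satisfiable TYPE('ag moment) CS \<Gamma>) \<and>
         (satisfiable TYPE('m) CS \<Gamma> \<longrightarrow> consistent CS \<Gamma>) \<and>
         (uni_satisfiable TYPE('m) CS \<Gamma> \<longrightarrow> consistent CS \<Gamma>)"
proof (intro conjI iffI impI)
  show uni: "uni_satisfiable TYPE('ag moment) CS \<Gamma>" if "consistent CS \<Gamma>"
    using consistent_imp_uni_satisfiable[OF assms that] .
  show "satisfiable TYPE('ag moment) CS \<Gamma>" if "consistent CS \<Gamma>"
    using uni_satisfiable_imp_satisfiable[OF uni[OF that]] .
  show "consistent CS \<Gamma>" if "satisfiable TYPE('ag moment) CS \<Gamma>"
    using satisfiable_imp_consistent[OF assms that] .
  show "consistent CS \<Gamma>" if "uni_satisfiable TYPE('ag moment) CS \<Gamma>"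
    using satisfiable_imp_consistent[OF assms uni_satisfiable_imp_satisfiable[OF that]] .
  show "consistent CS \<Gamma>" if "satisfiable TYPE('m) CS \<Gamma>"
    using satisfiable_imp_consistent[OF assms that] .
  show "consistent CS \<Gamma>" if "uni_satisfiable TYPE('m) CS \<Gamma>"
    using satisfiable_imp_consistent[OF assms uni_satisfiable_imp_satisfiable[OF that]] .
qed

end
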